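(* Let $f$ be quasi-hyperbolic on the compact set $X$, and let $r<\hat r$. Then for every $r_1$ with $0<r_1<r$ there exists $r_0>0$ with the following property. If $B_0\subset B_1\subset\mathbb C^2$ are concentric balls such that $B_j$ has radius $r_j$ ($j=0,1$), then for all $x',x''\in B_0\cap X$ the intersection $W^s_{x',r}\cap W^u_{x'',r}\cap B_1$ is nonempty.
   Context: $f:\mathbb C^2\to\mathbb C^2$ is a Hénon map, i.e. a finite composition of generalized complex Hénon maps $(x,y)\mapsto(y,p(y)-ax)$ with $a\ne0$ and $p$ a polynomial of degree at least $2$. $K^{\pm}$ is the set of points with bounded forward/backward orbit, $J^\pm=\partial K^\pm$, $J=J^+\cap J^-$; $J^*\subset J$ is the closure of the set of saddle periodic points. $G^+(z)=\lim_{n\to\infty}(\deg f)^{-n}\log(\|f^n(z)\|+1)$. Let $X\subset J$ be an $f$-invariant set with $J^*\subset\overline X$. The map $f$ is quasi-expanding on $X$ if through every $x\in X$ passes an unstable manifold $W^u_x$, the image of an injective holomorphic immersion $\psi_x:\mathbb C\to J^-$ with $\psi_x(0)=x$ and $\max_{|\zeta|\le1}G^+\circ\psi_x(\zeta)=1$, such that: $f(W^u_x)=W^u_{f(x)}$ for $x\in X$; $W^u_x$ and $W^u_y$ are equal or disjoint for $x,y\in X$; and the family $\Psi=\{\psi_x:x\in X\}$ is normal. It is quasi-contracting on $X$ if $f^{-1}$ is quasi-expanding on $X$, the corresponding curves being denoted $W^s_x\subset J^+$; it is quasi-hyperbolic on $X$ if both hold. $W^{s/u}_{x,r}$ is the connected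 component containing $x$ of $W^{s/u}_x\cap B(x,r)$ (in the intrinsic topology of $W^{s/u}_x$), where $B(x,r)$ is the open ball. The set of locally uniform limits of sequences in $\Psi$ is $\widehat\Psi$; for $\psi\in\widehat\Psi$, $\mathcal D_\psi(r)$ is the component of $\psi^{-1}(B(\psi(0),r))$ containing $0$. The number $\hat r>0$ is fixed small enough that the sets $\mathcal D_\psi(\hat r)$ lie in a common disk $\{|\zeta|<\rho^{\rm out}\}$ and contain a common disk $\{|\zeta|<\rho^{\rm in}\}$, $\rho^{\rm in}>0$, for all $\psi\in\widehat\Psi$, and likewise for the corresponding family of parametrizations of the stable manifolds; such $\hat r$ exists. *)

theory Defs
  imports "HOL-Complex_Analysis.Complex_Analysis" "HOL-Computational_Algebra.Polynomial"
begin

type_synonym C2 = "complex \<times> complex"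

definition generalized_henon :: "complex poly \<Rightarrow> complex \<Rightarrow> C2 \<Rightarrow> C2" where
  "generalized_henon p a = (\<lambda>(x, y). (y, poly p y - a * x))"

inductive henon_map :: "(C2 \<Rightarrow> C2) \<Rightarrow> bool" where
  basic: "a \<noteq> 0 \<Longrightarrow> degree p \<ge> 2 \<Longrightarrow> henon_map (generalized_henon p a)"
| comp: "henon_map f \<Longrightarrow> henon_map g \<Longrightarrow> henon_map (f \<circ> g)"

definition poly_map_degree_le :: "nat \<Rightarrow> (C2 \<Rightarrow> C2) \<Rightarrow> bool" where
  "poly_map_degree_le m f \<longleftrightarrow>
     (\<exists>c c' :: nat \<Rightarrow> nat \<Rightarrow> complex. \<forall>x y.
        f (x, y) = (\<Sum>i\<le>m. \<Sum>j\<le>m - i. c i j * x ^ i * y ^ j,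
                    \<Sum>i\<le>m. \<Sum>j\<le>m - i. c' i j * x ^ i * y ^ j))"

text \<open>The degree of a polynomial map: the maximum of the total degrees of its two components.\<close>

definition alg_degree :: "(C2 \<Rightarrow> C2) \<Rightarrow> nat" where
  "alg_degree f = (LEAST m. poly_map_degree_le m f)"

text \<open>The definitions below are used for \<open>f\<close> as well as for \<open>inv f\<close>, which is again a polynomial
  automorphism; the sets with a minus sign for \<open>f\<close> are the ones with a plus sign for \<open>inv f\<close>.\<close>

definition K_plus :: "(C2 \<Rightarrow> C2) \<Rightarrow> C2 set" where
  "K_plus f = {z. bounded (range (\<lambda>n. (f ^^ n) z))}"

definition K_minus :: "(C2 \<Rightarrow> C2) \<Rightarrow> C2 set" where
  "K_minus f = K_plus (inv f)"

definition J_plus :: "(C2 \<Rightarrow> C2) \<Rightarrow> C2 set" where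
  "J_plus f = frontier (K_plus f)"

definition J_minus :: "(C2 \<Rightarrow> C2) \<Rightarrow> C2 set" where
  "J_minus f = frontier (K_minus f)"

definition J_set :: "(C2 \<Rightarrow> C2) \<Rightarrow> C2 set" where
  "J_set f = J_plus f \<inter> J_minus f"

definition eigenvalue_of :: "(C2 \<Rightarrow> C2) \<Rightarrow> complex \<Rightarrow> bool" where
  "eigenvalue_of L \<mu> \<longleftrightarrow> (\<exists>v. v \<noteq> 0 \<and> L v = (\<mu> * fst v, \<mu> * snd v))"

definition saddle_periodic :: "(C2 \<Rightarrow> C2) \<Rightarrow> C2 \<Rightarrow> bool" where
  "saddle_periodic f z \<longleftrightarrow>
     (\<exists>n>0. (f ^^ n) z = z \<and>
        (\<exists>L \<mu> \<nu>. ((f ^^ n) has_derivative L) (at z) \<and>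
           eigenvalue_of L \<mu> \<and> eigenvalue_of L \<nu> \<and> cmod \<mu> < 1 \<and> 1 < cmod \<nu>))"

definition J_star :: "(C2 \<Rightarrow> C2) \<Rightarrow> C2 set" where
  "J_star f = closure {z. saddle_periodic f z}"

definition G_plus :: "(C2 \<Rightarrow> C2) \<Rightarrow> C2 \<Rightarrow> real" where
  "G_plus f z = lim (\<lambda>n. ln (norm ((f ^^ n) z) + 1) / real (alg_degree f) ^ n)"

definition injective_holomorphic_immersion :: "(complex \<Rightarrow> C2) \<Rightarrow> bool" where
  "injective_holomorphic_immersion \<psi> \<longleftrightarrow>
     inj \<psi> \<and> (\<lambda>\<zeta>. fst (\<psi> \<zeta>)) holomorphic_on UNIV \<and> (\<lambda>\<zeta>. snd (\<psi> \<zeta>)) holomorphic_on UNIV \<and>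
     (\<forall>\<zeta>. deriv (\<lambda>\<zeta>. fst (\<psi> \<zeta>)) \<zeta> \<noteq> 0 \<or> deriv (\<lambda>\<zeta>. snd (\<psi> \<zeta>)) \<zeta> \<noteq> 0)"

text \<open>Locally uniform convergence on the plane, i.e. uniform convergence on compact sets.\<close>

definition loc_unif_limit :: "(nat \<Rightarrow> complex \<Rightarrow> C2) \<Rightarrow> (complex \<Rightarrow> C2) \<Rightarrow> bool" where
  "loc_unif_limit \<sigma> g \<longleftrightarrow> (\<forall>K. compact K \<longrightarrow> uniform_limit K \<sigma> g sequentially)"

text \<open>Normality with finite limits. Divergence to infinity, which some authors also allow, cannot
  occur for the families below, whose members map 0 into the bounded set \<open>J\<close>.\<close>

definition normal_family :: "(complex \<Rightarrow> C2) set \<Rightarrow> bool" where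
  "normal_family \<Psi> \<longleftrightarrow>
     (\<forall>\<sigma>. range \<sigma> \<subseteq> \<Psi> \<longrightarrow> (\<exists>k g. strict_mono (k :: nat \<Rightarrow> nat) \<and> loc_unif_limit (\<sigma> \<circ> k) g))"

definition family_hat :: "(complex \<Rightarrow> C2) set \<Rightarrow> (complex \<Rightarrow> C2) set" where
  "family_hat \<Psi> = {g. \<exists>\<sigma>. range \<sigma> \<subseteq> \<Psi> \<and> loc_unif_limit \<sigma> g}"

text \<open>\<open>f\<close> is quasi-expanding on \<open>X\<close> iff this holds for some \<open>\<psi>\<close>. The parametrizations are a
  parameter because the local unstable manifolds depend on them: the unstable manifold through
  \<open>x\<close> is \<open>range (\<psi> x)\<close>. Only the values of \<open>\<psi>\<close> on \<open>X\<close> matter.\<close>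

definition quasi_expanding_via :: "(C2 \<Rightarrow> C2) \<Rightarrow> C2 set \<Rightarrow> (C2 \<Rightarrow> complex \<Rightarrow> C2) \<Rightarrow> bool" where
  "quasi_expanding_via f X \<psi> \<longleftrightarrow>
     X \<subseteq> J_set f \<and> f ` X = X \<and> J_star f \<subseteq> closure X \<and>
     (\<forall>x\<in>X. injective_holomorphic_immersion (\<psi> x) \<and> range (\<psi> x) \<subseteq> J_minus f \<and> \<psi> x 0 = x \<and>
        (\<forall>\<zeta>\<in>cball 0 1. G_plus f (\<psi> x \<zeta>) \<le> 1) \<and> (\<exists>\<zeta>\<in>cball 0 1. G_plus f (\<psi> x \<zeta>) = 1)) \<and>
     (\<forall>x\<in>X. f ` range (\<psi> x) = range (\<psi> (f x))) \<and>
     (\<forall>x\<in>X. \<forall>y\<in>X. range (\<psi> x) = range (\<psi> y) \<or> range (\<psi> x) \<inter> range (\<psi> y) = {}) \<and>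
     normal_family (\<psi> ` X)"

definition quasi_contracting_via :: "(C2 \<Rightarrow> C2) \<Rightarrow> C2 set \<Rightarrow> (C2 \<Rightarrow> complex \<Rightarrow> C2) \<Rightarrow> bool" where
  "quasi_contracting_via f X \<psi> \<longleftrightarrow> quasi_expanding_via (inv f) X \<psi>"

definition quasi_hyperbolic_via ::
  "(C2 \<Rightarrow> C2) \<Rightarrow> C2 set \<Rightarrow> (C2 \<Rightarrow> complex \<Rightarrow> C2) \<Rightarrow> (C2 \<Rightarrow> complex \<Rightarrow> C2) \<Rightarrow> bool" where
  "quasi_hyperbolic_via f X \<psi>s \<psi>u \<longleftrightarrow> quasi_contracting_via f X \<psi>s \<and> quasi_expanding_via f X \<psi>u"

definition param_domain :: "(complex \<Rightarrow> C2) \<Rightarrow> real \<Rightarrow> complex set" where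
  "param_domain \<psi> r = connected_component_set (\<psi> -` ball (\<psi> 0) r) 0"

text \<open>The component containing \<open>x = \<psi> 0\<close> of \<open>range \<psi> \<inter> ball x r\<close> in the intrinsic topology of
  \<open>range \<psi>\<close>, i.e. the topology for which the injective map \<open>\<psi>\<close> is a homeomorphism from the plane.\<close>

definition local_manifold :: "(complex \<Rightarrow> C2) \<Rightarrow> real \<Rightarrow> C2 set" where
  "local_manifold \<psi> r = \<psi> ` param_domain \<psi> r"

text \<open>The requirement on \<open>rhat\<close> for one of the two families of parametrizations.\<close>

definition admissible_radius :: "(complex \<Rightarrow> C2) set \<Rightarrow> real \<Rightarrow> bool" where
  "admissible_radius \<Psi> r \<longleftrightarrow> r > 0 \<and>
     (\<exists>\<rho>out. \<forall>\<psi>\<in>family_hat \<Psi>. param_domain \<psi> r \<subseteq> ball 0 \<rho>out) \<and>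
     (\<exists>\<rho>in>0. \<forall>\<psi>\<in>family_hat \<Psi>. ball 0 \<rho>in \<subseteq> param_domain \<psi> r)"

end

theory Submission
  imports Defs
begin

text \<open>Two facts carry the proof.

The first is local and concerns holomorphic curves only: if the curves \<open>A\<close> and \<open>B\<close>, the
latter not constant, meet at \<open>A 0 = B 0\<close> and \<open>A\<close> maps no disc around 0 into the image under \<open>B\<close> of a given
disc around 0, then nearby curves still meet near this point (\<open>isolated_intersection_persists\<close>). The proof
uses Puiseux parametrizations and the maximum principle.

The second is dynamical. Along the unstable curves \<open>f\<close> is linear, \<open>f (\<psi> x z) = \<psi> (f x) (l * z)\<close>, since two
injective parametrizations of the same immersed plane differ by an affine map
(\<open>same_image_reparametrization\<close>, \<open>entire_bijection_linear\<close>). The products of the multipliers \<open>l\<close> along orbits tend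
to infinity uniformly (\<open>cocycle_tends_to_infinity\<close>): otherwise a normal limit of the parametrizations would
be an entire curve contained in \<open>K_plus f\<close> and in the closure of \<open>K_minus f\<close>. The intersection of these sets is
bounded, so the curve would be constant, while the admissible radius excludes constant limits. Therefore the
iterates of \<open>inv f\<close> contract the unstable curves uniformly and, by symmetry, expand the stable ones.

Now suppose that the assertion fails at all scales. Compactness and normality give points \<open>x n\<close> and \<open>y n\<close>
of \<open>X\<close> approaching each other, whose stable and unstable curves converge to entire curves \<open>gs\<close> and \<open>gu\<close> with
\<open>gs 0 = gu 0\<close>, although small discs of the stable and unstable curves are disjoint. By the local fact a disc
of \<open>gs\<close> is contained in a disc of \<open>gu\<close>. But the first is stretched by backward iteration to a definite size, and the
second is shrunk to a point (\<open>stable_unstable_limits_differ\<close>).\<close>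

section \<open>Escape to infinity under Henon maps\<close>

lemma poly_superlinear_growth:
  fixes p :: "complex poly"
  assumes "degree p \<ge> 2"
  shows "\<exists>R>0. \<forall>z. R < cmod z \<longrightarrow> C * cmod z \<le> cmod (poly p z)"
proof -
  obtain a q where p: "p = pCons a q" by (cases p)
  have "degree q > 0"
    using assms unfolding p by (auto split: if_splits)
  then have "filterlim (\<lambda>z. cmod (poly q z)) at_top at_infinity"
    using filterlim_poly_at_infinity filterlim_at_infinity_imp_norm_at_top by blast
  then obtain r where r: "\<And>z. r \<le> cmod z \<Longrightarrow> C + 1 \<le> cmod (poly q z)"
    unfolding filterlim_at_top eventually_at_infinity by blast
  show ?thesis
  proof (intro exI conjI allI impI)
    show "max (max r (cmod a)) 1 > 0" by simp
    fix z assume z: "max (max r (cmod a)) 1 < cmod z"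
    have "(C + 1) * cmod z \<le> cmod (poly q z) * cmod z"
      using r[of z] z by (intro mult_right_mono) auto
    also have "\<dots> = cmod (poly p z - a)" unfolding p by (simp add: norm_mult mult.commute)
    also have "\<dots> \<le> cmod (poly p z) + cmod a" by (rule norm_triangle_ineq4)
    finally show "C * cmod z \<le> cmod (poly p z)" using z by (simp add: algebra_simps)
  qed
qed

text \<open>Under such a map the region \<open>cmod x \<le> cmod y\<close>, \<open>R < cmod y\<close> is forward invariant and escapes to
infinity. For the inverse of a Henon map the two coordinates exchange their roles, so its escape
region is expressed by conjugating with \<^term>\<open>prod.swap\<close>.\<close>
definition vertical_escape :: "real \<Rightarrow> (C2 \<Rightarrow> C2) \<Rightarrow> bool" where
  "vertical_escape R g \<longleftrightarrow> (\<forall>z. cmod (fst z) \<le> cmod (snd z) \<and> R < cmod (snd z) \<longrightarrow>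
     cmod (fst (g z)) \<le> cmod (snd (g z)) \<and> 2 * cmod (snd z) \<le> cmod (snd (g z)))"

definition entire_curve :: "(complex \<Rightarrow> C2) \<Rightarrow> bool" where
  "entire_curve c \<longleftrightarrow> (\<lambda>z. fst (c z)) holomorphic_on UNIV \<and> (\<lambda>z. snd (c z)) holomorphic_on UNIV"

definition preserves_entire :: "(C2 \<Rightarrow> C2) \<Rightarrow> bool" where
  "preserves_entire g \<longleftrightarrow> (\<forall>c. entire_curve c \<longrightarrow> entire_curve (\<lambda>z. g (c z)))"

lemma vertical_escapeD:
  assumes "vertical_escape R g" "cmod (fst z) \<le> cmod (snd z)" "R < cmod (snd z)"
  shows "cmod (fst (g z)) \<le> cmod (snd (g z))" "2 * cmod (snd z) \<le> cmod (snd (g z))"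
  using assms unfolding vertical_escape_def by blast+

lemma vertical_escape_mono: "vertical_escape R g \<Longrightarrow> R \<le> R' \<Longrightarrow> vertical_escape R' g"
  unfolding vertical_escape_def by force

lemma vertical_escape_comp:
  assumes "R > 0" "vertical_escape R g" "vertical_escape R h"
  shows "vertical_escape R (g \<circ> h)"
  unfolding vertical_escape_def
proof (intro allI impI)
  fix z assume z: "cmod (fst z) \<le> cmod (snd z) \<and> R < cmod (snd z)"
  then have 1: "cmod (fst (h z)) \<le> cmod (snd (h z))" "2 * cmod (snd z) \<le> cmod (snd (h z))"
    using vertical_escapeD[OF assms(3)] by auto
  then have "R < cmod (snd (h z))" using z assms(1) by linarith
  then have "cmod (fst (g (h z))) \<le> cmod (snd (g (h z)))" "2 * cmod (snd (h z)) \<le> cmod (snd (g (h z)))"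
    using vertical_escapeD[OF assms(2)] 1 by auto
  then show "cmod (fst ((g \<circ> h) z)) \<le> cmod (snd ((g \<circ> h) z)) \<and> 2 * cmod (snd z) \<le> cmod (snd ((g \<circ> h) z))"
    using 1(2) norm_ge_zero[of "snd (h z)"] unfolding o_def by (intro conjI; linarith)
qed

lemma vertical_escape_unbounded:
  assumes "R > 0" "vertical_escape R g" "cmod (fst z) \<le> cmod (snd z)" "R < cmod (snd z)"
  shows "\<not> bounded (range (\<lambda>n. (g ^^ n) z))"
proof
  have it: "cmod (fst ((g ^^ n) z)) \<le> cmod (snd ((g ^^ n) z)) \<and> 2 ^ n * cmod (snd z) \<le> cmod (snd ((g ^^ n) z))" for n
  proof (induction n)
    case (Suc n)
    have "1 * cmod (snd z) \<le> 2 ^ n * cmod (snd z)" by (rule mult_right_mono) auto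
    then have "R < cmod (snd ((g ^^ n) z))" using Suc assms(4) by linarith
    then have "cmod (fst ((g ^^ Suc n) z)) \<le> cmod (snd ((g ^^ Suc n) z))"
      "2 * cmod (snd ((g ^^ n) z)) \<le> cmod (snd ((g ^^ Suc n) z))"
      using vertical_escapeD[OF assms(2), of "(g ^^ n) z"] Suc by auto
    then show ?case using Suc by auto
  qed (use assms in auto)
  assume "bounded (range (\<lambda>n. (g ^^ n) z))"
  then obtain B where B: "\<And>n. norm ((g ^^ n) z) \<le> B" unfolding bounded_iff by auto
  obtain n where n: "B / cmod (snd z) < 2 ^ n" using real_arch_pow[of 2] by auto
  have "B < 2 ^ n * cmod (snd z)" using n assms by (simp add: divide_simps split: if_splits)
  also have "\<dots> \<le> cmod (snd ((g ^^ n) z))" using it by auto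
  also have "\<dots> \<le> norm ((g ^^ n) z)" by (metis norm_snd_le prod.collapse)
  finally show False using B[of n] by simp
qed

text \<open>For a single map \<open>(x, y) \<mapsto> (y, p y - a x)\<close> the polynomial \<open>p\<close> of degree at least two outgrows every
multiple of \<open>cmod y\<close>, hence also the term \<open>a x\<close> on the region \<open>cmod x \<le> cmod y\<close>; solving for \<open>x\<close>
gives the same estimate for the inverse. All the properties pass to compositions, once the two
escape radii are replaced by their maximum.\<close>
lemma henon_map_facts:
  assumes "henon_map f"
  shows "bij f \<and> continuous_on UNIV f \<and> continuous_on UNIV (inv f) \<and>
    preserves_entire f \<and> preserves_entire (inv f) \<and>
    (\<exists>R>0. vertical_escape R f \<and> vertical_escape R (prod.swap \<circ> inv f \<circ> prod.swap))"
  using assms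
proof induction
  case (basic a p)
  let ?f = "generalized_henon p a"
  let ?g = "\<lambda>z::C2. ((poly p (fst z) - snd z) / a, fst z)"
  have f: "?f = (\<lambda>z. (snd z, poly p (snd z) - a * fst z))"
    by (auto simp: generalized_henon_def split_beta)
  have gf: "?g \<circ> ?f = id" "?f \<circ> ?g = id" using basic(1) by (auto simp: f fun_eq_iff)
  have inv: "inv ?f = ?g" by (rule inv_unique_comp[OF gf(2,1)])
  obtain R1 where R1: "R1 > 0" "\<And>z. R1 < cmod z \<Longrightarrow> (2 + cmod a) * cmod z \<le> cmod (poly p z)"
    using poly_superlinear_growth[OF basic(2), of "2 + cmod a"] by auto
  obtain R2 where R2: "R2 > 0" "\<And>z. R2 < cmod z \<Longrightarrow> (2 * cmod a + 1) * cmod z \<le> cmod (poly p z)"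
    using poly_superlinear_growth[OF basic(2), of "2 * cmod a + 1"] by auto
  show ?case
  proof (intro conjI exI)
    show "bij ?f" using gf o_bij by blast
    show "continuous_on UNIV ?f" unfolding f by (intro continuous_intros)
    show "continuous_on UNIV (inv ?f)" unfolding inv
      using basic(1) by (intro continuous_intros) auto
    show "preserves_entire ?f" unfolding preserves_entire_def entire_curve_def f
    proof (intro allI impI conjI)
      fix c :: "complex \<Rightarrow> C2"
      assume c': "(\<lambda>z. fst (c z)) holomorphic_on UNIV \<and> (\<lambda>z. snd (c z)) holomorphic_on UNIV"
      then have c: "(\<lambda>z. fst (c z)) holomorphic_on UNIV" "(\<lambda>z. snd (c z)) holomorphic_on UNIV" by auto
      have "(poly p \<circ> (\<lambda>z. snd (c z))) holomorphic_on UNIV"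
        by (rule holomorphic_on_compose[OF c(2)]) (intro holomorphic_intros)
      then show "(\<lambda>z. snd (snd (c z), poly p (snd (c z)) - a * fst (c z))) holomorphic_on UNIV"
        using c by (auto simp: o_def intro!: holomorphic_intros)
    qed auto
    show "preserves_entire (inv ?f)" unfolding preserves_entire_def entire_curve_def inv
    proof (intro allI impI conjI)
      fix c :: "complex \<Rightarrow> C2"
      assume c': "(\<lambda>z. fst (c z)) holomorphic_on UNIV \<and> (\<lambda>z. snd (c z)) holomorphic_on UNIV"
      then have c: "(\<lambda>z. fst (c z)) holomorphic_on UNIV" "(\<lambda>z. snd (c z)) holomorphic_on UNIV" by auto
      have "(poly p \<circ> (\<lambda>z. fst (c z))) holomorphic_on UNIV"
        by (rule holomorphic_on_compose[OF c(1)]) (intro holomorphic_intros)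
      then show "(\<lambda>z. fst ((poly p (fst (c z)) - snd (c z)) / a, fst (c z))) holomorphic_on UNIV"
        using c basic(1) by (auto simp: o_def intro!: holomorphic_intros)
    qed auto
    show "max R1 R2 > 0" using R1 by auto
    have "vertical_escape R1 ?f" unfolding vertical_escape_def
    proof (intro allI impI)
      fix z :: C2 assume z: "cmod (fst z) \<le> cmod (snd z) \<and> R1 < cmod (snd z)"
      have "cmod a * cmod (fst z) \<le> cmod a * cmod (snd z)" using z by (intro mult_left_mono) auto
      moreover have "(2 + cmod a) * cmod (snd z) \<le> cmod (poly p (snd z))" using R1 z by auto
      moreover have "cmod (poly p (snd z)) \<le> cmod (poly p (snd z) - a * fst z) + cmod a * cmod (fst z)"
        by (metis diff_add_cancel norm_mult norm_triangle_ineq)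
      ultimately show "cmod (fst (?f z)) \<le> cmod (snd (?f z)) \<and> 2 * cmod (snd z) \<le> cmod (snd (?f z))"
        unfolding f using z R1 by (auto simp: algebra_simps)
    qed
    then show "vertical_escape (max R1 R2) ?f" by (rule vertical_escape_mono) auto
    have "vertical_escape R2 (prod.swap \<circ> inv ?f \<circ> prod.swap)" unfolding vertical_escape_def inv
    proof (intro allI impI)
      fix z :: C2 assume z: "cmod (fst z) \<le> cmod (snd z) \<and> R2 < cmod (snd z)"
      have "(2 * cmod a + 1) * cmod (snd z) \<le> cmod (poly p (snd z))" using R2 z by auto
      moreover have "cmod (poly p (snd z)) \<le> cmod (poly p (snd z) - fst z) + cmod (fst z)"
        by (metis diff_add_cancel norm_triangle_ineq)
      ultimately have "2 * cmod (snd z) * cmod a \<le> cmod (poly p (snd z) - fst z)"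
        using z by (auto simp: algebra_simps)
      then have "2 * cmod (snd z) \<le> cmod ((poly p (snd z) - fst z) / a)"
        using basic(1) by (simp add: norm_divide pos_le_divide_eq)
      then show "cmod (fst ((prod.swap \<circ> ?g \<circ> prod.swap) z)) \<le> cmod (snd ((prod.swap \<circ> ?g \<circ> prod.swap) z)) \<and>
        2 * cmod (snd z) \<le> cmod (snd ((prod.swap \<circ> ?g \<circ> prod.swap) z))"
        using z R2(1) norm_ge_zero[of "snd z"] unfolding o_def by (simp; linarith)
    qed
    then show "vertical_escape (max R1 R2) (prod.swap \<circ> inv ?f \<circ> prod.swap)" by (rule vertical_escape_mono) auto
  qed
next
  case (comp f g)
  have inv: "inv (f \<circ> g) = inv g \<circ> inv f" using comp by (intro o_inv_distrib) auto
  obtain R1 R2 where R: "R1 > 0" "vertical_escape R1 f" "vertical_escape R1 (prod.swap \<circ> inv f \<circ> prod.swap)"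
    "R2 > 0" "vertical_escape R2 g" "vertical_escape R2 (prod.swap \<circ> inv g \<circ> prod.swap)" using comp by blast
  let ?R = "max R1 R2"
  have R': "vertical_escape ?R f" "vertical_escape ?R (prod.swap \<circ> inv f \<circ> prod.swap)"
    "vertical_escape ?R g" "vertical_escape ?R (prod.swap \<circ> inv g \<circ> prod.swap)"
    by (rule vertical_escape_mono[OF R(2)] vertical_escape_mono[OF R(3)]
        vertical_escape_mono[OF R(5)] vertical_escape_mono[OF R(6)]; simp)+
  have Rpos: "?R > 0" using R by auto
  have sw: "prod.swap \<circ> (inv g \<circ> inv f) \<circ> prod.swap =
     (prod.swap \<circ> inv g \<circ> prod.swap) \<circ> (prod.swap \<circ> inv f \<circ> prod.swap)" by (auto simp: fun_eq_iff)
  show ?case unfolding inv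
  proof (intro conjI exI)
    show "bij (f \<circ> g)" using comp bij_comp by blast
    show "continuous_on UNIV (f \<circ> g)" 
      using comp by (intro continuous_on_compose) (auto intro: continuous_on_subset)
    show "continuous_on UNIV (inv g \<circ> inv f)" 
      using comp by (intro continuous_on_compose) (auto intro: continuous_on_subset)
    show "preserves_entire (f \<circ> g)" "preserves_entire (inv g \<circ> inv f)"
      using comp unfolding preserves_entire_def o_def by simp_all
    show "?R > 0" by fact
    show "vertical_escape ?R (f \<circ> g)" by (rule vertical_escape_comp) (use Rpos R' in auto)
    show "vertical_escape ?R (prod.swap \<circ> (inv g \<circ> inv f) \<circ> prod.swap)" unfolding sw
      by (rule vertical_escape_comp) (use Rpos R' in auto)
  qed
qed

text \<open>A point with a large coordinate lies in the vertical region, where \<open>g\<close> escapes, or in the horizontal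
one, where \<open>h\<close> escapes. The closure of \<open>K_plus h\<close> still avoids the interior of the horizontal region,
and the diagonal \<open>cmod x = cmod y\<close>, which both closed regions contain, can be left to \<open>g\<close>.
Symmetrically with \<open>g\<close> and \<open>h\<close> exchanged.\<close>
lemma escaping_sets_meet_in_bounded_set:
  assumes R: "R > 0" "vertical_escape R g" "vertical_escape R (prod.swap \<circ> h \<circ> prod.swap)"
  shows "bounded (K_plus g \<inter> closure (K_plus h))" "bounded (closure (K_plus g) \<inter> K_plus h)"
proof -
  let ?V = "{z::C2. cmod (fst z) \<le> cmod (snd z) \<and> R < cmod (snd z)}"
  let ?H = "{z::C2. cmod (snd z) \<le> cmod (fst z) \<and> R < cmod (fst z)}"
  let ?V' = "{z::C2. cmod (fst z) < cmod (snd z) \<and> R < cmod (snd z)}"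
  let ?H' = "{z::C2. cmod (snd z) < cmod (fst z) \<and> R < cmod (fst z)}"
  have V: "K_plus g \<inter> ?V = {}"
  proof (intro equals0I)
    fix z assume "z \<in> K_plus g \<inter> ?V"
    then show False using vertical_escape_unbounded[OF R(1,2), of z] unfolding K_plus_def by simp
  qed
  have H: "K_plus h \<inter> ?H = {}"
  proof (intro equals0I)
    fix z assume z: "z \<in> K_plus h \<inter> ?H"
    have it: "((prod.swap \<circ> h \<circ> prod.swap) ^^ n) (prod.swap z) = prod.swap ((h ^^ n) z)" for n
      by (induction n) simp_all
    have "\<not> bounded (range (\<lambda>n. prod.swap ((h ^^ n) z)))"
      using vertical_escape_unbounded[OF R(1,3), of "prod.swap z"] z unfolding it by simp
    moreover have "norm (prod.swap w) = norm w" for w :: C2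
      by (cases w) (simp add: norm_Pair add.commute)
    moreover have "bounded (range (\<lambda>n. (h ^^ n) z))" using z unfolding K_plus_def by simp
    ultimately show False unfolding bounded_iff by (metis (no_types, lifting) rangeE rangeI)
  qed
  have oV: "open ?V'" and oH: "open ?H'"
    by (intro open_Collect_conj open_Collect_less continuous_intros)+
  have cV: "closure (K_plus g) \<inter> ?V' = {}" using V oV open_Int_closure_eq_empty[of ?V' "K_plus g"] by auto
  have cH: "closure (K_plus h) \<inter> ?H' = {}" using H oH open_Int_closure_eq_empty[of ?H' "K_plus h"] by auto
  have bd: "norm z \<le> 2 * R" if "z \<notin> ?V \<and> z \<notin> ?H' \<or> z \<notin> ?V' \<and> z \<notin> ?H" for z :: C2
  proof -
    have "cmod (fst z) \<le> R" "cmod (snd z) \<le> R" using that unfolding mem_Collect_eq not_le not_less by argo+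
    then show ?thesis using norm_Pair_le[of "fst z" "snd z"] by simp
  qed
  show "bounded (K_plus g \<inter> closure (K_plus h))"
    unfolding bounded_iff
  proof (intro exI ballI)
    fix z assume "z \<in> K_plus g \<inter> closure (K_plus h)"
    then show "norm z \<le> 2 * R" using V cH by (intro bd disjI1 conjI) blast+
  qed
  show "bounded (closure (K_plus g) \<inter> K_plus h)"
    unfolding bounded_iff
  proof (intro exI ballI)
    fix z assume "z \<in> closure (K_plus g) \<inter> K_plus h"
    then show "norm z \<le> 2 * R" using H cV by (intro bd disjI2 conjI) blast+
  qed
qed

section \<open>Reparametrization of immersed entire curves\<close>

lemma countable_if_no_islimpt:
  fixes S :: "'a::second_countable_topology set"
  assumes "\<And>x. x \<in> S \<Longrightarrow> \<not> x islimpt S"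
  shows "countable S"
proof -
  have "\<forall>x\<in>S. \<exists>T. open T \<and> x \<in> T \<and> T \<inter> S = {x}"
  proof
    fix x assume "x \<in> S"
    obtain T where "open T" "x \<in> T" "\<forall>y\<in>S. y \<in> T \<longrightarrow> y = x"
      using assms[OF \<open>x \<in> S\<close>] unfolding islimpt_def by auto
    moreover from this have "T \<inter> S = {x}" using \<open>x \<in> S\<close> by blast
    ultimately show "\<exists>T. open T \<and> x \<in> T \<and> T \<inter> S = {x}" by blast
  qed
  from bchoice[OF this] obtain T where T: "\<forall>x\<in>S. open (T x) \<and> x \<in> T x \<and> T x \<inter> S = {x}" ..
  obtain F where F: "F \<subseteq> T ` S" "countable F" "\<Union>F = \<Union>(T ` S)"
    by (rule Lindelof[of "T ` S"]) (use T in auto)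
  have "S \<subseteq> \<Union>F" unfolding F(3) using T by blast
  then have "S \<subseteq> (\<Union>U\<in>F. U \<inter> S)" by blast
  moreover have "countable (U \<inter> S)" if U: "U \<in> F" for U
  proof -
    obtain x where "x \<in> S" "U = T x" using U F(1) by blast
    then have "U \<inter> S = {x}" using T by blast
    then show ?thesis by simp
  qed
  ultimately show ?thesis using F(2) by (meson countable_UN countable_subset)
qed

text \<open>The map \<open>G\<close> is the local inverse of the coordinate function \<open>\<pi> \<circ> \<psi>\<close> composed with \<open>\<pi>\<close>. It is
defined on an open subset of the space \<open>C2\<close> and not only on the curve, so that it can be applied to any
other curve passing nearby.\<close>
lemma local_inverse_through_coordinate:
  fixes \<pi> :: "C2 \<Rightarrow> complex" and \<psi> :: "complex \<Rightarrow> C2"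
  assumes "continuous_on UNIV \<pi>" "(\<lambda>w. \<pi> (\<psi> w)) holomorphic_on UNIV" "deriv (\<lambda>w. \<pi> (\<psi> w)) w0 \<noteq> 0"
  obtains B W G where "open B" "w0 \<in> B" "open W" "\<psi> ` B \<subseteq> W" "G ` W \<subseteq> B"
    "\<And>w. w \<in> B \<Longrightarrow> G (\<psi> w) = w"
    "\<And>\<phi> D. (\<lambda>z. \<pi> (\<phi> z)) holomorphic_on D \<Longrightarrow> \<phi> ` D \<subseteq> W \<Longrightarrow> (\<lambda>z. G (\<phi> z)) holomorphic_on D"
proof -
  let ?u = "\<lambda>w. \<pi> (\<psi> w)"
  obtain r where r: "r > 0" "open (?u ` ball w0 r)" "inj_on ?u (ball w0 r)"
    using has_complex_derivative_locally_invertible[OF assms(2) _ open_UNIV assms(3)] by auto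
  have hol: "?u holomorphic_on ball w0 r" using assms(2) holomorphic_on_subset by blast
  obtain g where g: "g holomorphic_on (?u ` ball w0 r)" "\<And>z. z \<in> ball w0 r \<Longrightarrow> g (?u z) = z"
    using holomorphic_has_inverse[OF hol open_ball r(3)] by metis
  show ?thesis
  proof (rule that[of "ball w0 r" "\<pi> -` (?u ` ball w0 r)" "\<lambda>p. g (\<pi> p)"])
    show "open (\<pi> -` (?u ` ball w0 r))" using assms(1) r(2) by (metis open_vimage)
    show "(\<lambda>z. g (\<pi> (\<phi> z))) holomorphic_on D"
      if "(\<lambda>z. \<pi> (\<phi> z)) holomorphic_on D" "\<phi> ` D \<subseteq> \<pi> -` (?u ` ball w0 r)" for \<phi> :: "complex \<Rightarrow> C2" and D
      using holomorphic_on_compose_gen[OF that(1) g(1)] that(2) by (auto simp: o_def)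
  qed (use r g in auto)
qed

lemma immersion_local_inverse:
  assumes "injective_holomorphic_immersion \<psi>"
  obtains B W G where "open B" "w0 \<in> B" "open W" "\<psi> ` B \<subseteq> W" "G ` W \<subseteq> B"
    "\<And>w. w \<in> B \<Longrightarrow> G (\<psi> w) = w"
    "\<And>\<phi> D. (\<lambda>z. fst (\<phi> z)) holomorphic_on D \<Longrightarrow> (\<lambda>z. snd (\<phi> z)) holomorphic_on D \<Longrightarrow>
       \<phi> ` D \<subseteq> W \<Longrightarrow> (\<lambda>z. G (\<phi> z)) holomorphic_on D"
proof (cases "deriv (\<lambda>\<zeta>. fst (\<psi> \<zeta>)) w0 = 0")
  case False
  show ?thesis
    by (rule local_inverse_through_coordinate[OF _ _ False])
       (use assms that in \<open>auto simp: injective_holomorphic_immersion_def intro: continuous_intros\<close>)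
next
  case True
  then have nz: "deriv (\<lambda>\<zeta>. snd (\<psi> \<zeta>)) w0 \<noteq> 0"
    using assms unfolding injective_holomorphic_immersion_def by blast
  show ?thesis
    by (rule local_inverse_through_coordinate[OF _ _ nz])
       (use assms that in \<open>auto simp: injective_holomorphic_immersion_def intro: continuous_intros\<close>)
qed

lemma entire_curve_continuous:
  assumes "entire_curve \<phi>"
  shows "continuous_on S \<phi>"
proof -
  have "continuous_on UNIV (\<lambda>z. (fst (\<phi> z), snd (\<phi> z)))"
    using assms unfolding entire_curve_def by (intro continuous_on_Pair holomorphic_on_imp_continuous_on) auto
  then have "continuous_on UNIV \<phi>" by simp
  then show ?thesis by (rule continuous_on_subset) simp
qed

lemma immersion_entire_curve: "injective_holomorphic_immersion \<psi> \<Longrightarrow> entire_curve \<psi>"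
  unfolding injective_holomorphic_immersion_def entire_curve_def by blast

lemma bounded_entire_curve_constant:
  assumes "entire_curve \<phi>" and "bounded (range \<phi>)"
  shows "\<phi> z = \<phi> 0"
proof -
  have "(\<lambda>z. fst (\<phi> z)) constant_on UNIV" "(\<lambda>z. snd (\<phi> z)) constant_on UNIV"
    using assms(1) bounded_fst[OF assms(2)] bounded_snd[OF assms(2)]
    by (auto intro!: Liouville_theorem simp: image_image entire_curve_def)
  then show ?thesis unfolding constant_on_def by (metis UNIV_I prod_eqI)
qed

lemma circle_avoiding_countable:
  fixes z0 :: complex
  assumes "countable E"
  obtains \<delta> where "\<delta> > 0" "sphere z0 \<delta> \<inter> E = {}"
proof -
  have "countable (dist z0 ` E)" using assms by simp
  moreover have "uncountable {0<..<1::real}" by (simp add: uncountable_open_interval)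
  ultimately obtain \<delta> where "\<delta> \<in> {0<..<1}" "\<delta> \<notin> dist z0 ` E" by (metis countable_subset subsetI)
  then show ?thesis by (intro that[of \<delta>]) auto
qed

text \<open>The bijection \<open>h = inv \<psi> \<circ> \<phi>\<close> need not be continuous a priori, because the image of an injective
immersion may accumulate on itself. Let \<open>A\<close> be the open set on which \<open>h\<close> is holomorphic.

Near a point \<open>z1\<close> with \<open>h z1\<close> in a small chart \<open>B\<close> of \<open>\<psi>\<close> the image of \<open>B\<close> is given by the equation
\<open>\<psi> (G p) = p\<close>. If \<open>z1\<close> is a limit of parameters with \<open>h z\<close> in \<open>B\<close>, the identity theorem makes \<open>\<phi>\<close>
satisfy this equation on a whole disc around \<open>z1\<close>, so \<open>z1\<close> lies in \<open>A\<close>. Hence the complement of \<open>A\<close> is a countable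
union of discrete sets, that is, countable.

A countable exceptional set is removed as follows. Around \<open>z0\<close> there is a circle contained in \<open>A\<close>,
whose \<open>h\<close>-image is bounded, say by \<open>M\<close>. Up to a countable set, the connected region \<open>cmod w > M\<close> is
covered by the disjoint open images of the inside and the outside of the circle, hence by one of
them. The inside cannot be the one, since then \<open>\<psi>\<close> would be bounded near infinity and Liouville's theorem
would make it constant. So \<open>h\<close> is bounded on the inside, and a bounded \<open>h\<close> is continuous because
\<open>\<psi>\<close> is continuous and injective.\<close>
proposition same_image_reparametrization:
  assumes \<psi>: "injective_holomorphic_immersion \<psi>"
    and inj\<phi>: "inj \<phi>" and \<phi>': "entire_curve \<phi>"
    and range: "range \<phi> = range \<psi>"
  obtains h where "h holomorphic_on UNIV" "bij h" "\<And>z. \<phi> z = \<psi> (h z)"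
proof -
  define h where "h = inv \<psi> \<circ> \<phi>"
  have \<phi>: "inj \<phi>" "(\<lambda>z. fst (\<phi> z)) holomorphic_on UNIV" "(\<lambda>z. snd (\<phi> z)) holomorphic_on UNIV"
    using inj\<phi> \<phi>' unfolding entire_curve_def by auto
  have inj\<psi>: "inj \<psi>" and hol\<psi>: "(\<lambda>z. fst (\<psi> z)) holomorphic_on UNIV" "(\<lambda>z. snd (\<psi> z)) holomorphic_on UNIV"
    using \<psi> unfolding injective_holomorphic_immersion_def by auto
  have cont: "continuous_on UNIV \<phi>" "continuous_on UNIV \<psi>"
    using entire_curve_continuous \<phi>' immersion_entire_curve[OF \<psi>] by auto
  have \<psi>h: "\<psi> (h z) = \<phi> z" for z
    unfolding h_def o_def by (rule f_inv_into_f) (metis range rangeI)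
  have injh: "inj h" using \<phi>(1) \<psi>h by (metis injD injI)
  moreover have "surj h"
  proof -
    have "\<exists>z. w = h z" for w
    proof -
      obtain z where "\<psi> w = \<phi> z" using range by (metis rangeE rangeI)
      then show ?thesis using \<psi>h inj\<psi> by (metis injD)
    qed
    then show ?thesis by (auto simp: surj_def)
  qed
  ultimately have bij: "bij h" by (simp add: bij_def)

  define A where "A = {z. \<exists>e>0. h holomorphic_on ball z e}"
  have A_ball: "ball z e \<subseteq> A" if "h holomorphic_on ball z e" for z e
  proof
    fix y assume y: "y \<in> ball z e"
    then have "ball y (e - dist z y) \<subseteq> ball z e"
      by (auto simp: dist_commute) (smt (verit) dist_commute dist_triangle)
    then show "y \<in> A" using that y holomorphic_on_subset unfolding A_def
      by (intro CollectI exI[of _ "e - dist z y"]) auto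
  qed
  have openA: "open A"
    unfolding open_contains_ball
  proof
    fix z assume "z \<in> A"
    then obtain e where "e > 0" "h holomorphic_on ball z e" unfolding A_def by blast
    then show "\<exists>e>0. ball z e \<subseteq> A" using A_ball by blast
  qed
  have holA: "h holomorphic_on A"
    unfolding holomorphic_on_open[OF openA]
  proof
    fix z assume "z \<in> A"
    then obtain e where "e > 0" "h holomorphic_on ball z e" unfolding A_def by blast
    then show "\<exists>f'. (h has_field_derivative f') (at z)"
      using holomorphic_on_open[OF open_ball, of h z e] by auto
  qed

  \<comment> \<open>If the values of \<open>h\<close> at parameters accumulating at \<open>z1\<close> lie in a single chart containing \<open>h z1\<close>,
    then \<open>h = G \<circ> \<phi>\<close> on a disc around \<open>z1\<close>.\<close>
  have islimpt_A: "z1 \<in> A"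
    if B: "open B" "open W" "\<psi> ` B \<subseteq> W" "G ` W \<subseteq> B" "\<And>w. w \<in> B \<Longrightarrow> G (\<psi> w) = w"
      and G: "\<And>\<phi> D. (\<lambda>z. fst (\<phi> z)) holomorphic_on D \<Longrightarrow> (\<lambda>z. snd (\<phi> z)) holomorphic_on D \<Longrightarrow>
       \<phi> ` D \<subseteq> W \<Longrightarrow> (\<lambda>z. G (\<phi> z)) holomorphic_on D"
      and z1: "h z1 \<in> B" "z1 islimpt {z. h z \<in> B}" for B W G z1
  proof -
    have "z1 \<in> \<phi> -` W" using \<psi>h[of z1] B(3) z1(1) by (metis imageI subsetD vimageI)
    moreover have "open (\<phi> -` W)" using cont(1) B(2) open_vimage by blast
    ultimately obtain e where e: "e > 0" "ball z1 e \<subseteq> \<phi> -` W"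
      using open_contains_ball by blast
    have holG: "(\<lambda>z. G (\<phi> z)) holomorphic_on ball z1 e"
      using e \<phi> by (intro G) (auto intro: holomorphic_on_subset)
    have lim: "z1 islimpt (ball z1 e \<inter> {z. h z \<in> B})"
    proof -
      have "z1 islimpt {z. h z \<in> B} \<inter> ball z1 e"
        using z1(2) e(1) by (intro islimpt_Int_eventually eventually_at_in_open') auto
      then show ?thesis by (simp add: Int_commute)
    qed
    have 1: "\<pi> (\<psi> (G (\<phi> z))) - \<pi> (\<phi> z) = 0"
      if \<pi>: "(\<lambda>z. \<pi> (\<psi> z)) holomorphic_on UNIV" "(\<lambda>z. \<pi> (\<phi> z)) holomorphic_on UNIV" and z: "z \<in> ball z1 e"
      for \<pi> :: "C2 \<Rightarrow> complex" and z
    proof (rule analytic_continuation[OF _ open_ball connected_ball _ _ lim _ z])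
      have "(\<lambda>z. \<pi> (\<psi> (G (\<phi> z)))) holomorphic_on ball z1 e"
        using holomorphic_on_compose_gen[OF holG \<pi>(1)] by (simp add: o_def)
      then show "(\<lambda>z. \<pi> (\<psi> (G (\<phi> z))) - \<pi> (\<phi> z)) holomorphic_on ball z1 e"
        using \<pi>(2) by (intro holomorphic_intros) (auto intro: holomorphic_on_subset)
      show "\<pi> (\<psi> (G (\<phi> y))) - \<pi> (\<phi> y) = 0" if "y \<in> ball z1 e \<inter> {z. h z \<in> B}" for y
        using that B(5)[of "h y"] \<psi>h[of y] by simp
    qed (use e in auto)
    have "h z = G (\<phi> z)" if "z \<in> ball z1 e" for z
    proof -
      have "\<psi> (G (\<phi> z)) = \<psi> (h z)"
        using 1[of fst z] 1[of snd z] that \<phi> hol\<psi> by (simp add: \<psi>h prod_eq_iff)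
      then show ?thesis using inj\<psi> by (metis injD)
    qed
    from this[symmetric] have "h holomorphic_on ball z1 e" by (rule holomorphic_transform[OF holG])
    then show ?thesis using e(1) unfolding A_def by blast
  qed

  have countE: "countable (- A)"
  proof -
    have "\<forall>w. \<exists>B. open B \<and> w \<in> B \<and> countable (- A \<inter> {z. h z \<in> B})"
    proof
      fix w
      obtain B W G where B: "open B" "w \<in> B" "open W" "\<psi> ` B \<subseteq> W" "G ` W \<subseteq> B" "\<And>w. w \<in> B \<Longrightarrow> G (\<psi> w) = w"
        "\<And>\<phi> D. (\<lambda>z. fst (\<phi> z)) holomorphic_on D \<Longrightarrow> (\<lambda>z. snd (\<phi> z)) holomorphic_on D \<Longrightarrow>
           \<phi> ` D \<subseteq> W \<Longrightarrow> (\<lambda>z. G (\<phi> z)) holomorphic_on D"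
        using immersion_local_inverse[OF \<psi>, of w] by metis
      have "countable (- A \<inter> {z. h z \<in> B})"
      proof (rule countable_if_no_islimpt)
        fix x assume x: "x \<in> - A \<inter> {z. h z \<in> B}"
        then have "\<not> x islimpt {z. h z \<in> B}" using islimpt_A[OF B(1,3-7)] by blast
        then show "\<not> x islimpt (- A \<inter> {z. h z \<in> B})" by (meson inf_le2 islimpt_subset)
      qed
      then show "\<exists>B. open B \<and> w \<in> B \<and> countable (- A \<inter> {z. h z \<in> B})" using B by blast
    qed
    then obtain B where B: "\<And>w. open (B w) \<and> w \<in> B w \<and> countable (- A \<inter> {z. h z \<in> B w})" by metis
    obtain F where F: "F \<subseteq> range B" "countable F" "\<Union>F = \<Union>(range B)"
      by (rule Lindelof[of "range B"]) (use B in auto)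
    have "- A \<subseteq> (\<Union>U\<in>F. - A \<inter> {z. h z \<in> U})" using F(3) B by blast
    moreover have "countable (- A \<inter> {z. h z \<in> U})" if "U \<in> F" for U using that F(1) B by auto
    ultimately show ?thesis using F(2) by (meson countable_UN countable_subset)
  qed

  \<comment> \<open>If \<open>z1\<close> were not in \<open>A\<close>, the chart around \<open>h z1\<close> would be missed on a punctured disc around \<open>z1\<close>,
    whereas bounded values of \<open>h\<close> can only accumulate at \<open>h z1\<close>.\<close>
  have bounded_A: "z1 \<in> A" if e: "e > 0" and bd: "bounded (h ` (ball z1 e \<inter> A))" for z1 e
  proof (rule ccontr)
    assume nA: "z1 \<notin> A"
    obtain B W G where B: "open B" "h z1 \<in> B" "open W" "\<psi> ` B \<subseteq> W" "G ` W \<subseteq> B" "\<And>w. w \<in> B \<Longrightarrow> G (\<psi> w) = w"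
        "\<And>\<phi> D. (\<lambda>z. fst (\<phi> z)) holomorphic_on D \<Longrightarrow> (\<lambda>z. snd (\<phi> z)) holomorphic_on D \<Longrightarrow>
           \<phi> ` D \<subseteq> W \<Longrightarrow> (\<lambda>z. G (\<phi> z)) holomorphic_on D"
      using immersion_local_inverse[OF \<psi>, of "h z1"] by metis
    have "\<not> z1 islimpt {z. h z \<in> B}" using islimpt_A[OF B(1,3-7) B(2)] nA by blast
    then obtain d where d: "d > 0" "\<And>z. h z \<in> B \<Longrightarrow> z \<noteq> z1 \<Longrightarrow> dist z z1 \<ge> d"
      unfolding islimpt_approachable by (auto simp: not_less)
    have "\<exists>z. z \<in> A \<and> dist z z1 < min e d / real (Suc n)" for n
    proof -
      have "\<not> ball z1 (min e d / real (Suc n)) \<subseteq> - A"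
        using countE countable_subset uncountable_ball[of "min e d / real (Suc n)" z1] e d(1) by auto
      then show ?thesis by (auto simp: dist_commute)
    qed
    then obtain \<sigma> where \<sigma>: "\<And>n. \<sigma> n \<in> A" "\<And>n. dist (\<sigma> n) z1 < min e d / real (Suc n)" by metis
    have small: "dist (\<sigma> n) z1 < min e d" for n
    proof -
      have "min e d / real (Suc n) \<le> min e d" using e d(1) divide_left_mono[of 1 "real (Suc n)" "min e d"] by simp
      then show ?thesis using \<sigma>(2)[of n] by linarith
    qed
    have "(\<lambda>n. dist (\<sigma> n) z1) \<longlonglongrightarrow> 0"
    proof (rule tendsto_sandwich[OF _ _ tendsto_const])
      show "(\<lambda>n. min e d / real (Suc n)) \<longlonglongrightarrow> 0" by (rule LIMSEQ_Suc[OF lim_const_over_n])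
    qed (use \<sigma>(2) in \<open>auto intro!: always_eventually less_imp_le\<close>)
    then have \<sigma>lim: "\<sigma> \<longlonglongrightarrow> z1" using tendsto_dist_iff by blast
    have "h (\<sigma> n) \<in> h ` (ball z1 e \<inter> A)" for n
      using \<sigma>(1)[of n] small[of n] by (auto simp: dist_commute)
    then have "bounded (range (h \<circ> \<sigma>))" using bd by (auto intro: bounded_subset)
    then obtain w k where wk: "strict_mono (k :: nat \<Rightarrow> nat)" "((h \<circ> \<sigma>) \<circ> k) \<longlonglongrightarrow> w"
      using bounded_imp_convergent_subsequence by blast
    have "(\<lambda>n. \<psi> (((h \<circ> \<sigma>) \<circ> k) n)) \<longlonglongrightarrow> \<psi> w"
      by (rule continuous_on_tendsto_compose[OF cont(2) wk(2)]) auto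
    moreover have "(\<lambda>n. \<phi> ((\<sigma> \<circ> k) n)) \<longlonglongrightarrow> \<phi> z1"
      by (rule continuous_on_tendsto_compose[OF cont(1) LIMSEQ_subseq_LIMSEQ[OF \<sigma>lim wk(1)]]) auto
    ultimately have "\<psi> w = \<phi> z1" using LIMSEQ_unique by (auto simp: \<psi>h)
    then have "w = h z1" using \<psi>h inj\<psi> by (metis injD)
    then have "eventually (\<lambda>n. ((h \<circ> \<sigma>) \<circ> k) n \<in> B) sequentially"
      using wk(2) B(1,2) topological_tendstoD by metis
    then obtain n where "h (\<sigma> (k n)) \<in> B" by (auto simp: eventually_sequentially)
    then show False using d(2) small[of "k n"] \<sigma>(1)[of "k n"] nA by fastforce
  qed

  have "z0 \<in> A" for z0
  proof (rule ccontr)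
    assume nA: "z0 \<notin> A"
    obtain \<delta> where \<delta>: "\<delta> > 0" "sphere z0 \<delta> \<inter> - A = {}" using circle_avoiding_countable[OF countE] .
    have cpt: "compact (h ` sphere z0 \<delta>)"
      using \<delta>(2) holomorphic_on_imp_continuous_on[OF holA]
      by (intro compact_continuous_image) (auto intro: continuous_on_subset)
    obtain M where M: "\<And>z. z \<in> sphere z0 \<delta> \<Longrightarrow> cmod (h z) \<le> M"
      using compact_imp_bounded[OF cpt] unfolding bounded_iff ball_simps by metis
    let ?D = "ball z0 \<delta> \<inter> A" and ?D' = "(- cball z0 \<delta>) \<inter> A"
    let ?U = "(- cball 0 M) - h ` (- A)"
    have conn: "connected ?U"
      by (intro connected_open_diff_countable connected_complement_bounded_convex)
         (auto simp: countE)
    have op: "open (h ` ?D)" "open (h ` ?D')"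
      using openA injh holA by (auto intro!: open_mapping_thm3 intro: holomorphic_on_subset inj_on_subset)
    have cov: "?U \<subseteq> h ` ?D \<union> h ` ?D'"
    proof
      fix w assume w: "w \<in> ?U"
      obtain z where z: "w = h z" using bij by (metis bij_pointE)
      have "z \<in> A" "z \<notin> sphere z0 \<delta>" using w z M[of z] by auto
      then show "w \<in> h ` ?D \<union> h ` ?D'" using z by (cases "z \<in> ball z0 \<delta>") auto
    qed
    have dis: "h ` ?D \<inter> h ` ?D' = {}" using injh by (auto simp: inj_eq)
    show False
    proof (cases "h ` ?D \<inter> ?U = {}")
      case True
      have "h ` ?D \<subseteq> cball 0 M"
      proof
        fix w assume "w \<in> h ` ?D"
        then show "w \<in> cball 0 M" using True injh by (auto simp: inj_eq)
      qed
      then show False using bounded_A[OF \<delta>(1)] nA bounded_cball bounded_subset by blast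
    next
      case False
      then have "h ` ?D' \<inter> ?U = {}"
        using connectedD[OF conn op] cov dis by blast
      then have sub: "?U \<subseteq> h ` ?D" using cov by blast
      have cpt2: "compact (\<phi> ` cball z0 \<delta>)" "compact (\<psi> ` cball 0 M)"
        using cont by (auto intro!: compact_continuous_image intro: continuous_on_subset)
      have \<psi>U: "\<psi> ` ?U \<subseteq> \<phi> ` cball z0 \<delta>" using sub \<psi>h by force
      have dense: "- cball 0 M \<subseteq> closure ?U"
      proof
        fix w :: complex assume w: "w \<in> - cball 0 M"
        show "w \<in> closure ?U"
        proof (rule ccontr)
          assume "w \<notin> closure ?U"
          then have "w \<in> - cball 0 M \<inter> - closure ?U" using w by blast
          then obtain e where e: "e > 0" "ball w e \<subseteq> - cball 0 M \<inter> - closure ?U"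
            by (meson openE open_Compl open_Int closed_cball closed_closure)
          then have "ball w e \<subseteq> h ` (- A)" using closure_subset[of ?U] by blast
          then show False using uncountable_ball[OF e(1)] countE countable_subset by blast
        qed
      qed
      have \<psi>cl: "\<psi> ` closure ?U \<subseteq> closure (\<psi> ` ?U)"
        using cont(2) by (meson continuous_image_closure_subset top_greatest)
      have "range \<psi> \<subseteq> \<psi> ` cball 0 M \<union> closure (\<phi> ` cball z0 \<delta>)"
      proof
        fix p assume "p \<in> range \<psi>"
        then obtain w where w: "p = \<psi> w" by blast
        show "p \<in> \<psi> ` cball 0 M \<union> closure (\<phi> ` cball z0 \<delta>)"
        proof (cases "w \<in> cball 0 M")
          case False
          then have "w \<in> closure ?U" using dense by auto
          then have "p \<in> closure (\<psi> ` ?U)" using \<psi>cl w by blast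
          then show ?thesis using closure_mono[OF \<psi>U] by blast
        qed (use w in auto)
      qed
      then have "bounded (range \<psi>)"
        using cpt2 by (meson bounded_Un bounded_closure bounded_subset compact_imp_bounded)
      then have "\<psi> 1 = \<psi> 0" using bounded_entire_curve_constant[OF immersion_entire_curve[OF \<psi>]] by blast
      then show False using inj\<psi> by (metis injD zero_neq_one)
    qed
  qed
  then have "A = UNIV" by blast
  then show ?thesis using that holA bij \<psi>h by metis
qed

text \<open>The inverse of \<open>h\<close> is continuous, so \<open>h\<close> is proper and therefore a polynomial. Injectivity makes its
derivative a polynomial without zeros, hence constant.\<close>
lemma entire_bijection_linear:
  assumes h: "h holomorphic_on UNIV" "bij h" "h 0 = 0"
  obtains l :: complex where "l \<noteq> 0" "\<And>z. h z = l * z"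
proof -
  have inj: "inj h" using h(2) by (rule bij_is_inj)
  obtain g where g: "g holomorphic_on range h" "\<And>z. g (h z) = z"
    using holomorphic_has_inverse[OF h(1) open_UNIV inj] by (metis UNIV_I)
  have surj: "range h = UNIV" using h(2) by (simp add: bij_is_surj)
  have hg: "h (g w) = w" for w using g(2) surj by (metis surjD)
  have cpt: "compact {z. h z \<in> k}" if "compact k" for k
  proof -
    have "{z. h z \<in> k} = g ` k"
    proof (intro equalityI subsetI)
      fix z assume "z \<in> {z. h z \<in> k}"
      then show "z \<in> g ` k" using g(2)[of z] by (intro image_eqI[of _ _ "h z"]) auto
    qed (use hg in auto)
    moreover have "continuous_on k g"
      using g(1) unfolding surj by (meson continuous_on_subset holomorphic_on_imp_continuous_on top_greatest)
    ultimately show ?thesis using that compact_continuous_image by metis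
  qed
  then obtain c n where cn: "0 < n" "c n \<noteq> 0" "h = (\<lambda>z. \<Sum>i\<le>n. c i * z^i)"
    using proper_map_polyfun_eq[OF h(1)] by blast
  have der: "deriv h z = (\<Sum>i\<le>n - 1. (of_nat (Suc i) * c (Suc i)) * z ^ i)" for z
  proof (rule DERIV_imp_deriv)
    have "((\<lambda>z. \<Sum>i\<le>n. c i * z^i) has_field_derivative (\<Sum>i\<le>n. c i * (of_nat i * z ^ (i - 1)))) (at z)"
      by (auto intro!: derivative_eq_intros sum.cong)
    moreover have "(\<Sum>i\<le>n. c i * (of_nat i * z ^ (i - 1))) = (\<Sum>i\<le>n - 1. (of_nat (Suc i) * c (Suc i)) * z ^ i)"
    proof -
      obtain m where m: "n = Suc m" using cn(1) by (cases n) auto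
      show ?thesis unfolding m sum.atMost_Suc_shift by (simp add: algebra_simps)
    qed
    ultimately show "(h has_field_derivative (\<Sum>i\<le>n - 1. (of_nat (Suc i) * c (Suc i)) * z ^ i)) (at z)"
      unfolding cn(3) by simp
  qed
  have "n = 1"
  proof (rule ccontr)
    assume "n \<noteq> 1"
    then have "\<exists>i\<in>{1..n - 1}. of_nat (Suc i) * c (Suc i) \<noteq> 0"
      using cn by (intro bexI[of _ "n - 1"]) (auto simp del: of_nat_Suc)
    then obtain z where "deriv h z = 0"
      using fundamental_theorem_of_algebra[of "\<lambda>i. of_nat (Suc i) * c (Suc i)" "n - 1"] unfolding der by metis
    then show False using holomorphic_injective_imp_regular[OF h(1) open_UNIV inj] by auto
  qed
  then have "h z = c 0 + c 1 * z" for z using cn(3) by simp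
  moreover from this[of 0] have "c 0 = 0" using h(3) by simp
  ultimately show ?thesis using that[of "c 1"] cn(2) \<open>n = 1\<close> by simp
qed

section \<open>Intersections of holomorphic curves\<close>

lemma holomorphic_on_ball_isCont:
  assumes "f holomorphic_on ball x r" "0 < r"
  shows "isCont f x"
proof -
  have "continuous_on (ball x r) f" using assms(1) by (rule holomorphic_on_imp_continuous_on)
  then show ?thesis using assms(2) by (simp add: continuous_on_eq_continuous_at)
qed

lemma nonconstant_entire_order:
  fixes f :: "complex \<Rightarrow> complex"
  assumes "f holomorphic_on UNIV" "f w1 \<noteq> f w2"
  obtains n where "0 < n" "(deriv ^^ n) f z \<noteq> 0" "\<And>i. 0 < i \<Longrightarrow> i < n \<Longrightarrow> (deriv ^^ i) f z = 0"
proof -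
  have "\<exists>n. 0 < n \<and> (deriv ^^ n) f z \<noteq> 0"
  proof (rule ccontr)
    assume "\<not> ?thesis"
    then have "f w = f z" for w
      using holomorphic_fun_eq_const_on_connected[OF assms(1) open_UNIV connected_UNIV, of z w] by blast
    then show False using assms(2) by metis
  qed
  then have *: "0 < (LEAST n. 0 < n \<and> (deriv ^^ n) f z \<noteq> 0) \<and>
    (deriv ^^ (LEAST n. 0 < n \<and> (deriv ^^ n) f z \<noteq> 0)) f z \<noteq> 0"
    by (rule LeastI_ex)
  show ?thesis
  proof (rule that)
    show "(deriv ^^ i) f z = 0" if "0 < i" "i < (LEAST n. 0 < n \<and> (deriv ^^ n) f z \<noteq> 0)" for i
      using not_less_Least[OF that(2)] that(1) by simp
  qed (use * in auto)
qed

lemma nonvanishing_holomorphic_nth_root: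
  fixes e :: "complex \<Rightarrow> complex"
  assumes "e holomorphic_on ball x r" "\<And>z. z \<in> ball x r \<Longrightarrow> e z \<noteq> 0" "0 < k"
  obtains q where "q holomorphic_on ball x r" "\<And>z. z \<in> ball x r \<Longrightarrow> q z ^ k = e z"
proof -
  obtain L where L: "L holomorphic_on ball x r" "\<And>z. z \<in> ball x r \<Longrightarrow> e z = exp (L z)"
    using contractible_imp_holomorphic_log[OF assms(1) _ assms(2)] convex_imp_contractible[OF convex_ball]
    by metis
  show ?thesis
  proof (rule that[of "\<lambda>z. exp (L z / of_nat k)"])
    show "(\<lambda>z. exp (L z / of_nat k)) holomorphic_on ball x r"
      using L(1) assms(3) by (intro holomorphic_intros) auto
    show "exp (L z / of_nat k) ^ k = e z" if "z \<in> ball x r" for z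
      using L(2)[OF that] assms(3) by (simp flip: exp_of_nat_mult)
  qed
qed

text \<open>If \<open>a z - a z0\<close> has a zero of order \<open>m\<close> at \<open>z0\<close>, it acquires a zero of order \<open>k * m\<close> under the substitution
\<open>z0 + t ^ k\<close>, and the remaining nonvanishing factor has a holomorphic root on a disc. A constant \<open>a\<close> is
included, with \<open>s = 0\<close>.\<close>
lemma root_after_power_substitution:
  fixes a :: "complex \<Rightarrow> complex"
  assumes a: "a holomorphic_on UNIV" and k: "0 < k"
  obtains s \<epsilon> where "0 < \<epsilon>" "s holomorphic_on ball 0 \<epsilon>" "s 0 = 0"
    "\<And>t. t \<in> ball 0 \<epsilon> \<Longrightarrow> s t ^ k = a (z0 + t ^ k) - a z0"
proof (cases "\<forall>z. a z = a z0")
  case True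
  then have "a (z0 + t ^ k) = a z0" for t by blast
  then show ?thesis by (intro that[of 1 "\<lambda>_. 0"]) (use k in \<open>auto simp: power_0_left\<close>)
next
  case False
  then obtain z1 where "a z1 \<noteq> a z0" by blast
  from nonconstant_entire_order[OF a this, of z0] obtain m where m: "0 < m" "(deriv ^^ m) a z0 \<noteq> 0"
    "\<And>i. 0 < i \<Longrightarrow> i < m \<Longrightarrow> (deriv ^^ i) a z0 = 0" by metis
  obtain e r where r: "0 < r" "e holomorphic_on ball z0 r"
    "\<And>z. z \<in> ball z0 r \<Longrightarrow> a z - a z0 = (z - z0) ^ m * e z" "\<And>z. z \<in> ball z0 r \<Longrightarrow> e z \<noteq> 0"
    by (rule holomorphic_factor_order_of_zero[OF a open_UNIV _ m]) auto
  obtain q where q: "q holomorphic_on ball z0 r" "\<And>z. z \<in> ball z0 r \<Longrightarrow> q z ^ k = e z"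
    using nonvanishing_holomorphic_nth_root[OF r(2,4) k] by metis
  define \<epsilon> where "\<epsilon> = min r 1"
  have in_ball: "z0 + t ^ k \<in> ball z0 r" if "t \<in> ball 0 \<epsilon>" for t
  proof -
    have "cmod (t ^ k) \<le> cmod t"
      using that k power_le_one_iff[of "cmod t"] power_decreasing[of 1 k "cmod t"] unfolding \<epsilon>_def
      by (simp add: norm_power)
    then show ?thesis using that unfolding \<epsilon>_def by (simp add: dist_norm)
  qed
  show ?thesis
  proof (rule that[of \<epsilon> "\<lambda>t. t ^ m * q (z0 + t ^ k)"])
    have "(q \<circ> (\<lambda>t. z0 + t ^ k)) holomorphic_on ball 0 \<epsilon>"
      by (rule holomorphic_on_compose_gen[OF _ q(1)]) (use in_ball in \<open>auto intro!: holomorphic_intros\<close>)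
    then show "(\<lambda>t. t ^ m * q (z0 + t ^ k)) holomorphic_on ball 0 \<epsilon>"
      unfolding o_def by (intro holomorphic_intros)
    show "(t ^ m * q (z0 + t ^ k)) ^ k = a (z0 + t ^ k) - a z0" if "t \<in> ball 0 \<epsilon>" for t
    proof -
      have "(t ^ m * q (z0 + t ^ k)) ^ k = (t ^ m) ^ k * e (z0 + t ^ k)"
        using q(2)[OF in_ball[OF that]] by (simp add: power_mult_distrib)
      also have "(t ^ m) ^ k = (t ^ k) ^ m" by (simp add: mult.commute flip: power_mult)
      also have "(t ^ k) ^ m * e (z0 + t ^ k) = a (z0 + t ^ k) - a z0"
        using r(3)[OF in_ball[OF that]] by simp
      finally show ?thesis .
    qed
  qed (use r(1) m(1) in \<open>auto simp: \<epsilon>_def\<close>)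
qed

text \<open>Puiseux parametrization of the curve \<open>a z = b w\<close> near \<open>(z0, w0)\<close>. In a suitable local coordinate
\<open>\<beta>\<close> one has \<open>b w - b w0 = \<beta> w ^ k\<close>, and after substituting \<open>z = z0 + t ^ k\<close> the right-hand side
\<open>a z - a z0\<close> is a \<open>k\<close>-th power \<open>s t ^ k\<close>. The \<open>k\<close> solutions are \<open>\<beta> w = \<omega> * s t\<close> with \<open>\<omega>\<close> running over
the \<open>k\<close>-th roots of unity.\<close>
proposition fibre_parametrization:
  fixes a b :: "complex \<Rightarrow> complex"
  assumes a: "a holomorphic_on UNIV" and b: "b holomorphic_on UNIV"
    and nc: "b w1 \<noteq> b w2" and ab: "a z0 = b w0"
  obtains k \<epsilon> \<delta> W where "0 < k" "0 < \<epsilon>" "0 < \<delta>"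
    "\<forall>\<omega>::complex. \<omega> ^ k = 1 \<longrightarrow> W \<omega> holomorphic_on ball 0 \<epsilon> \<and> W \<omega> 0 = w0"
    "\<forall>\<omega>::complex. \<forall>t\<in>ball 0 \<epsilon>. \<omega> ^ k = 1 \<longrightarrow> b (W \<omega> t) = a (z0 + t ^ k)"
    "\<forall>w\<in>ball w0 \<delta>. \<forall>t\<in>ball 0 \<epsilon>. b w = a (z0 + t ^ k) \<longrightarrow> (\<exists>\<omega>::complex. \<omega> ^ k = 1 \<and> w = W \<omega> t)"
proof -
  from nonconstant_entire_order[OF b nc, of w0] obtain k where k: "0 < k" "(deriv ^^ k) b w0 \<noteq> 0"
    "\<And>i. 0 < i \<Longrightarrow> i < k \<Longrightarrow> (deriv ^^ i) b w0 = 0" by metis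
  obtain g r where r: "0 < r" "g holomorphic_on ball w0 r"
    "\<And>w. w \<in> ball w0 r \<Longrightarrow> b w - b w0 = ((w - w0) * g w) ^ k" "\<And>w. w \<in> ball w0 r \<Longrightarrow> g w \<noteq> 0"
    by (rule holomorphic_factor_order_of_zero_strong[OF b open_UNIV _ k]) auto
  define \<beta> where "\<beta> = (\<lambda>w. (w - w0) * g w)"
  have hol\<beta>: "\<beta> holomorphic_on ball w0 r" unfolding \<beta>_def using r(2) by (intro holomorphic_intros)
  have "(\<beta> has_field_derivative g w0) (at w0)"
  proof -
    have "(g has_field_derivative deriv g w0) (at w0)"
      using r(1,2) by (intro holomorphic_derivI[OF _ open_ball]) auto
    then show ?thesis unfolding \<beta>_def by (auto intro!: derivative_eq_intros)
  qed
  then have "deriv \<beta> w0 \<noteq> 0" using DERIV_imp_deriv r(1,4) by (metis centre_in_ball)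
  then obtain \<delta> where \<delta>: "\<delta> > 0" "ball w0 \<delta> \<subseteq> ball w0 r" "open (\<beta> ` ball w0 \<delta>)" "inj_on \<beta> (ball w0 \<delta>)"
    using has_complex_derivative_locally_invertible[OF hol\<beta> _ open_ball] r(1) by (metis centre_in_ball)
  have "\<beta> holomorphic_on ball w0 \<delta>" using hol\<beta> \<delta>(2) holomorphic_on_subset by blast
  then obtain \<gamma> where \<gamma>: "\<gamma> holomorphic_on \<beta> ` ball w0 \<delta>" "\<And>w. w \<in> ball w0 \<delta> \<Longrightarrow> \<gamma> (\<beta> w) = w"
    using holomorphic_has_inverse[OF _ open_ball \<delta>(4)] by metis
  have \<beta>0: "\<beta> w0 = 0" unfolding \<beta>_def by simp
  then have "0 \<in> \<beta> ` ball w0 \<delta>" using \<delta>(1) by (metis centre_in_ball imageI)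
  then obtain \<eta> where \<eta>: "\<eta> > 0" "ball 0 \<eta> \<subseteq> \<beta> ` ball w0 \<delta>"
    using \<delta>(3) open_contains_ball by blast
  obtain s \<epsilon>0 where s: "0 < \<epsilon>0" "s holomorphic_on ball 0 \<epsilon>0" "s 0 = 0"
    "\<And>t. t \<in> ball 0 \<epsilon>0 \<Longrightarrow> s t ^ k = a (z0 + t ^ k) - a z0"
    using root_after_power_substitution[OF a k(1), of z0] by metis
  have "isCont s 0" using holomorphic_on_ball_isCont[OF s(2,1)] .
  then obtain \<epsilon>1 where \<epsilon>1: "\<epsilon>1 > 0" "\<And>t. dist t 0 < \<epsilon>1 \<Longrightarrow> dist (s t) (s 0) < \<eta>"
    using \<eta>(1) unfolding continuous_at_eps_delta by blast
  define \<epsilon> where "\<epsilon> = min \<epsilon>0 \<epsilon>1"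
  have one: "cmod \<omega> = 1" if "\<omega> ^ k = 1" for \<omega> :: complex
    using that k(1) by (metis norm_ge_zero norm_one norm_power power_eq_1_iff gr_implies_not_zero power_eq_imp_eq_base power_one zero_le_one)
  have sV: "\<omega> * s t \<in> \<beta> ` ball w0 \<delta>" if "\<omega> ^ k = 1" "t \<in> ball 0 \<epsilon>" for \<omega> t
  proof -
    have "cmod (\<omega> * s t) < \<eta>"
      using \<epsilon>1(2)[of t] that(2) one[OF that(1)] s(3) unfolding \<epsilon>_def by (simp add: norm_mult)
    then show ?thesis using \<eta>(2) by auto
  qed
  have kth: "\<beta> w ^ k = b w - b w0" if "w \<in> ball w0 \<delta>" for w
    using r(3)[of w] that \<delta>(2) unfolding \<beta>_def by auto
  show ?thesis
  proof (rule that[of k \<epsilon> \<delta> "\<lambda>\<omega> t. \<gamma> (\<omega> * s t)"])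
    show "\<forall>\<omega>::complex. \<omega> ^ k = 1 \<longrightarrow> (\<lambda>t. \<gamma> (\<omega> * s t)) holomorphic_on ball 0 \<epsilon> \<and> \<gamma> (\<omega> * s 0) = w0"
    proof (intro allI impI conjI)
      fix \<omega> :: complex assume \<omega>: "\<omega> ^ k = 1"
      have "(\<gamma> \<circ> (\<lambda>t. \<omega> * s t)) holomorphic_on ball 0 \<epsilon>"
      proof (rule holomorphic_on_compose_gen[OF _ \<gamma>(1)])
        show "(\<lambda>t. \<omega> * s t) holomorphic_on ball 0 \<epsilon>"
          using s(2) unfolding \<epsilon>_def by (intro holomorphic_intros) (auto intro: holomorphic_on_subset)
      qed (use sV[OF \<omega>] in auto)
      then show "(\<lambda>t. \<gamma> (\<omega> * s t)) holomorphic_on ball 0 \<epsilon>" by (simp add: o_def)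
      show "\<gamma> (\<omega> * s 0) = w0" using \<gamma>(2)[of w0] \<beta>0 s(3) \<delta>(1) by simp
    qed
  next
    show "\<forall>\<omega>::complex. \<forall>t\<in>ball 0 \<epsilon>. \<omega> ^ k = 1 \<longrightarrow> b (\<gamma> (\<omega> * s t)) = a (z0 + t ^ k)"
    proof (intro allI ballI impI)
      fix \<omega> t :: complex assume \<omega>: "\<omega> ^ k = 1" and t: "t \<in> ball 0 \<epsilon>"
      obtain w where w: "w \<in> ball w0 \<delta>" "\<omega> * s t = \<beta> w" using sV[OF \<omega> t] by blast
      then have "b w - b w0 = (\<omega> * s t) ^ k" using kth by simp
      also have "\<dots> = a (z0 + t ^ k) - a z0" using s(4)[of t] t \<omega> unfolding \<epsilon>_def by (simp add: power_mult_distrib)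
      finally show "b (\<gamma> (\<omega> * s t)) = a (z0 + t ^ k)" using \<gamma>(2)[OF w(1)] w(2) ab by simp
    qed
  next
    show "\<forall>w\<in>ball w0 \<delta>. \<forall>t\<in>ball 0 \<epsilon>. b w = a (z0 + t ^ k) \<longrightarrow> (\<exists>\<omega>::complex. \<omega> ^ k = 1 \<and> w = \<gamma> (\<omega> * s t))"
    proof (intro ballI impI)
      fix w t assume w: "w \<in> ball w0 \<delta>" and t: "t \<in> ball 0 \<epsilon>" and eq: "b w = a (z0 + t ^ k)"
      have eq': "\<beta> w ^ k = s t ^ k" using kth[OF w] s(4)[of t] t eq ab unfolding \<epsilon>_def by simp
      show "\<exists>\<omega>. \<omega> ^ k = 1 \<and> w = \<gamma> (\<omega> * s t)"
      proof (cases "s t = 0")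
        case True
        then have "\<beta> w = 0" using eq' k(1) by (simp add: power_0_left)
        then show ?thesis using True \<gamma>(2)[OF w] by (intro exI[of _ 1]) simp
      next
        case False
        then show ?thesis using eq' \<gamma>(2)[OF w] by (intro exI[of _ "\<beta> w / s t"]) (simp add: power_divide)
      qed
    qed
  qed (use k \<delta> s(1) \<epsilon>1 in \<open>auto simp: \<epsilon>_def\<close>)
qed

lemma complex_nth_root_exists:
  fixes z :: complex
  assumes "0 < k" obtains t where "t ^ k = z"
proof -
  have "\<exists>t. t ^ k = z"
  proof (cases "z = 0")
    case True then show ?thesis using assms by (intro exI[of _ 0]) simp
  next
    case False
    then have "exp (Ln z / of_nat k) ^ k = z" using assms by (simp flip: exp_of_nat_mult)
    then show ?thesis by blast
  qed
  then show ?thesis using that by blast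
qed

text \<open>On each Puiseux branch \<open>W \<omega>\<close> of the equality of first coordinates the difference of the second
coordinates is holomorphic in \<open>t\<close>. Each intersection point annihilates one of these differences, so
their product over all \<open>\<omega>\<close> has an accumulating sequence of zeros and vanishes identically. Thus for every
small \<open>z = t ^ k\<close> one branch solves both coordinate equations.\<close>
proposition accumulating_intersections_coincide:
  assumes A: "entire_curve A" and B: "entire_curve B"
    and nc: "fst (B w1) \<noteq> fst (B w2)" and AB: "A 0 = B 0"
    and z: "z \<longlonglongrightarrow> 0" "\<And>n::nat. z n \<noteq> 0" and w: "w \<longlonglongrightarrow> 0"
    and eq: "\<And>n. A (z n) = B (w n)" and \<sigma>: "0 < \<sigma>"
  shows "\<exists>\<rho>>0. A ` ball 0 \<rho> \<subseteq> B ` ball 0 \<sigma>"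
proof -
  have hol: "(\<lambda>z. fst (A z)) holomorphic_on UNIV" "(\<lambda>z. snd (A z)) holomorphic_on UNIV"
    "(\<lambda>z. fst (B z)) holomorphic_on UNIV" "(\<lambda>z. snd (B z)) holomorphic_on UNIV"
    using A B unfolding entire_curve_def by auto
  have "fst (A 0) = fst (B 0)" using AB by simp
  then obtain k \<epsilon> \<delta> W where k: "0 < k" "0 < \<epsilon>" "0 < \<delta>"
    and WW: "\<forall>\<omega>::complex. \<omega> ^ k = 1 \<longrightarrow> W \<omega> holomorphic_on ball 0 \<epsilon> \<and> W \<omega> 0 = 0"
    "\<forall>\<omega>::complex. \<forall>t\<in>ball 0 \<epsilon>. \<omega> ^ k = 1 \<longrightarrow> fst (B (W \<omega> t)) = fst (A (0 + t ^ k))"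
    "\<forall>w\<in>ball 0 \<delta>. \<forall>t\<in>ball 0 \<epsilon>. fst (B w) = fst (A (0 + t ^ k)) \<longrightarrow> (\<exists>\<omega>::complex. \<omega> ^ k = 1 \<and> w = W \<omega> t)"
    by (rule fibre_parametrization[OF hol(1,3) nc])
  have W: "W \<omega> holomorphic_on ball 0 \<epsilon>" "W \<omega> 0 = 0"
    "t \<in> ball 0 \<epsilon> \<Longrightarrow> fst (B (W \<omega> t)) = fst (A (0 + t ^ k))" if "\<omega> ^ k = 1" for \<omega> t
    using WW(1,2) that by auto
  define R where "R = {\<omega>::complex. \<omega> ^ k = 1}"
  have finR: "finite R" unfolding R_def using k(1) by (intro finite_roots_unity) auto
  define P where "P = (\<lambda>t. \<Prod>\<omega>\<in>R. snd (A (t ^ k)) - snd (B (W \<omega> t)))"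
  have holP: "P holomorphic_on ball 0 \<epsilon>"
    unfolding P_def
  proof (intro holomorphic_on_prod holomorphic_on_diff)
    have "((\<lambda>z. snd (A z)) \<circ> (\<lambda>t. t ^ k)) holomorphic_on ball 0 \<epsilon>"
      by (rule holomorphic_on_compose_gen[OF _ hol(2)]) (auto intro!: holomorphic_intros)
    then show "(\<lambda>t. snd (A (t ^ k))) holomorphic_on ball 0 \<epsilon>" by (simp add: o_def)
    fix \<omega> assume "\<omega> \<in> R"
    then have "((\<lambda>z. snd (B z)) \<circ> W \<omega>) holomorphic_on ball 0 \<epsilon>"
      by (intro holomorphic_on_compose_gen[OF W(1) hol(4)]) (auto simp: R_def)
    then show "(\<lambda>t. snd (B (W \<omega> t))) holomorphic_on ball 0 \<epsilon>" by (simp add: o_def)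
  qed
  have "\<exists>t. t ^ k = z n" for n using complex_nth_root_exists[OF k(1)] by metis
  then obtain t where t: "\<And>n. t n ^ k = z n" by metis
  have tlim: "t \<longlonglongrightarrow> 0"
  proof (rule LIMSEQ_I)
    fix e :: real assume e: "e > 0"
    then have "eventually (\<lambda>n. dist (z n) 0 < e ^ k) sequentially" using tendstoD[OF z(1)] by simp
    then have "eventually (\<lambda>n. norm (t n - 0) < e) sequentially"
    proof eventually_elim
      case (elim n)
      then have "cmod (t n) ^ k < e ^ k" using t[of n] by (simp flip: norm_power)
      then show ?case using e power_less_imp_less_base[of "cmod (t n)" k e] by simp
    qed
    then show "\<exists>N. \<forall>n\<ge>N. norm (t n - 0) < e" by (simp add: eventually_sequentially)
  qed
  have lim: "0 islimpt {t \<in> ball 0 \<epsilon>. P t = 0}"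
    unfolding islimpt_approachable
  proof (intro allI impI)
    fix e :: real assume e: "e > 0"
    have "eventually (\<lambda>n. dist (t n) 0 < min e \<epsilon>) sequentially" "eventually (\<lambda>n. dist (w n) 0 < \<delta>) sequentially"
      using tendstoD[OF tlim, of "min e \<epsilon>"] tendstoD[OF w, of \<delta>] e k by auto
    then have "eventually (\<lambda>n. dist (t n) 0 < min e \<epsilon> \<and> dist (w n) 0 < \<delta>) sequentially"
      by (rule eventually_conj)
    then obtain n where n: "dist (t n) 0 < min e \<epsilon>" "dist (w n) 0 < \<delta>"
      by (auto simp: eventually_sequentially)
    have "\<exists>\<omega>. \<omega> ^ k = 1 \<and> w n = W \<omega> (t n)"
      using n t[of n] eq[of n] by (intro WW(3)[rule_format]) (auto simp: dist_commute)
    then obtain \<omega> where "\<omega> \<in> R" "w n = W \<omega> (t n)" unfolding R_def by blast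
    then have "P (t n) = 0"
      unfolding P_def using eq[of n] t[of n] finR by (intro prod_zero) auto
    moreover have "t n \<noteq> 0" using t[of n] z(2)[of n] k(1) by (metis power_0_left not_gr_zero)
    ultimately show "\<exists>x'\<in>{t \<in> ball 0 \<epsilon>. P t = 0}. x' \<noteq> 0 \<and> dist x' 0 < e"
      using n by (intro bexI[of _ "t n"]) auto
  qed
  have P0: "P x = 0" if "x \<in> ball 0 \<epsilon>" for x
    by (rule analytic_continuation[OF holP open_ball connected_ball _ _ lim _ that]) (use k in auto)
  have "\<forall>\<omega>\<in>R. eventually (\<lambda>x. W \<omega> x \<in> ball 0 \<sigma>) (nhds 0)"
  proof
    fix \<omega> assume "\<omega> \<in> R"
    then have \<omega>: "\<omega> ^ k = 1" by (simp add: R_def)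
    have "(W \<omega> \<longlongrightarrow> W \<omega> 0) (nhds 0)"
      using holomorphic_on_ball_isCont[OF W(1)[OF \<omega>] k(2)] tendsto_at_iff_tendsto_nhds
      unfolding isCont_def by blast
    then have "(W \<omega> \<longlongrightarrow> 0) (nhds 0)" using W(2)[OF \<omega>] by simp
    then show "eventually (\<lambda>x. W \<omega> x \<in> ball 0 \<sigma>) (nhds 0)"
      using \<sigma> topological_tendstoD[of "W \<omega>" 0 "nhds 0" "ball 0 \<sigma>"] by simp
  qed
  then have "eventually (\<lambda>x. \<forall>\<omega>\<in>R. W \<omega> x \<in> ball 0 \<sigma>) (nhds 0)"
    using finR by (simp add: eventually_ball_finite)
  then obtain \<epsilon>1 where \<epsilon>1: "\<epsilon>1 > 0" "\<And>x. dist x 0 < \<epsilon>1 \<Longrightarrow> \<forall>\<omega>\<in>R. W \<omega> x \<in> ball 0 \<sigma>"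
    unfolding eventually_nhds_metric by blast
  define e where "e = min \<epsilon> \<epsilon>1"
  show ?thesis
  proof (intro exI conjI subsetI)
    show "e ^ k > 0" using \<epsilon>1(1) k unfolding e_def by simp
    fix p assume "p \<in> A ` ball 0 (e ^ k)"
    then obtain y where y: "p = A y" "cmod y < e ^ k" by auto
    obtain x where x: "x ^ k = y" using complex_nth_root_exists[OF k(1)] by metis
    have "cmod x ^ k < e ^ k" using y(2) x by (metis norm_power)
    then have xe: "cmod x < e" using \<epsilon>1(1) k(2) power_less_imp_less_base[of "cmod x" k e] unfolding e_def by simp
    then have "P x = 0" using P0[of x] unfolding e_def by simp
    then obtain \<omega> where \<omega>: "\<omega> \<in> R" "snd (A (x ^ k)) = snd (B (W \<omega> x))"
      unfolding P_def using finR by auto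
    have "fst (B (W \<omega> x)) = fst (A (x ^ k))" using W(3)[of \<omega> x] \<omega>(1) xe unfolding R_def e_def by simp
    then have "p = B (W \<omega> x)" using \<omega>(2) x y(1) by (simp add: prod_eq_iff)
    moreover have "W \<omega> x \<in> ball 0 \<sigma>" using \<epsilon>1(2)[of x] xe \<omega>(1) unfolding e_def by simp
    ultimately show "p \<in> B ` ball 0 \<sigma>" by blast
  qed
qed

text \<open>On the analytic set \<open>S\<close> where the first coordinates agree, minimize the distance of \<open>A z\<close> and \<open>B w\<close>. Since
the pair \<open>(0, w0)\<close> beats the bound \<open>\<eta>\<close> on the boundary of the bidisc, minimizers are interior. If the minimum
were positive, the maximum principle along a Puiseux branch would make the distance constant on the branch, so that the
minimizers would contain parameters \<open>z\<close> filling a neighbourhood of every minimizing \<open>z\<close>. This contradicts the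
existence of a minimizer with \<open>cmod z\<close> largest.\<close>
lemma separated_on_boundary_meet_inside:
  assumes A: "entire_curve A" and B: "entire_curve B"
    and nc: "fst (B w1) \<noteq> fst (B w2)"
    and pos: "0 < \<rho>" "0 < \<sigma>"
    and sep: "\<And>z w. cmod z = \<rho> \<Longrightarrow> cmod w \<le> \<sigma> \<Longrightarrow> \<eta> \<le> dist (A z) (B w)"
      "\<And>z w. cmod z \<le> \<rho> \<Longrightarrow> cmod w = \<sigma> \<Longrightarrow> \<eta> \<le> dist (A z) (B w)"
    and near: "cmod w0 \<le> \<sigma>" "fst (A 0) = fst (B w0)" "dist (A 0) (B w0) < \<eta>"
  shows "\<exists>z\<in>ball 0 \<rho>. \<exists>w\<in>ball 0 \<sigma>. A z = B w"
proof -
  have hol: "(\<lambda>z. fst (A z)) holomorphic_on UNIV" "(\<lambda>z. snd (A z)) holomorphic_on UNIV"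
    "(\<lambda>z. fst (B z)) holomorphic_on UNIV" "(\<lambda>z. snd (B z)) holomorphic_on UNIV"
    using A B unfolding entire_curve_def by auto
  define F where "F = (\<lambda>p::complex \<times> complex. dist (A (fst p)) (B (snd p)))"
  define S where "S = (cball 0 \<rho> \<times> cball 0 \<sigma>) \<inter> {p. fst (A (fst p)) = fst (B (snd p))}"
  have contA: "continuous_on UNIV (\<lambda>p::complex \<times> complex. A (fst p))"
    by (rule continuous_on_compose2[OF entire_curve_continuous[OF A, of UNIV]]) (auto intro: continuous_intros)
  have contB: "continuous_on UNIV (\<lambda>p::complex \<times> complex. B (snd p))"
    by (rule continuous_on_compose2[OF entire_curve_continuous[OF B, of UNIV]]) (auto intro: continuous_intros)
  have contF: "continuous_on T F" for T
    unfolding F_def using contA contB by (intro continuous_intros) (auto intro: continuous_on_subset)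
  have cS: "compact S"
    unfolding S_def
    by (intro compact_Int_closed compact_Times compact_cball closed_Collect_eq continuous_on_fst contA contB)
  have w0S: "(0, w0) \<in> S" unfolding S_def using near pos by simp
  then have "S \<noteq> {}" by blast
  from continuous_attains_inf[OF cS this contF] obtain p0
    where p0: "p0 \<in> S" "\<And>p. p \<in> S \<Longrightarrow> F p0 \<le> F p" by metis
  have small: "F p0 < \<eta>" using p0(2)[OF w0S] near(3) unfolding F_def by simp
  have inside: "cmod (fst p) < \<rho> \<and> cmod (snd p) < \<sigma>" if "p \<in> S" "F p = F p0" for p
    using sep(1)[of "fst p" "snd p"] sep(2)[of "fst p" "snd p"] that small unfolding S_def F_def
    by (cases "cmod (fst p) = \<rho>"; cases "cmod (snd p) = \<sigma>") (auto simp: mem_Times_iff)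
  have F_snd: "F p = cmod (snd (A (fst p)) - snd (B (snd p)))" if "fst (A (fst p)) = fst (B (snd p))" for p
    using that unfolding F_def by (simp add: dist_prod_def dist_norm)
  have "F p0 = 0"
  proof (rule ccontr)
    assume ne: "F p0 \<noteq> 0"
    define M where "M = S \<inter> {p. F p = F p0}"
    have cM: "compact M" unfolding M_def
      by (intro compact_Int_closed cS closed_Collect_eq contF continuous_on_const)
    have "M \<noteq> {}" unfolding M_def using p0(1) by blast
    moreover have "continuous_on M (\<lambda>p. cmod (fst p))" by (intro continuous_intros)
    ultimately have "\<exists>q\<in>M. \<forall>p\<in>M. cmod (fst p) \<le> cmod (fst q)"
      by (rule continuous_attains_sup[OF cM])
    then obtain q where q: "q \<in> M" "\<And>p. p \<in> M \<Longrightarrow> cmod (fst p) \<le> cmod (fst q)" by metis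
    obtain zq wq where zw: "q = (zq, wq)" by (cases q)
    have ab: "fst (A zq) = fst (B wq)" and ins: "cmod zq < \<rho>" "cmod wq < \<sigma>"
      using q(1) inside[of q] unfolding M_def S_def zw by auto
    obtain k \<epsilon> \<delta> V where k: "0 < k" "0 < \<epsilon>" "0 < \<delta>"
      and V: "\<forall>\<omega>::complex. \<omega> ^ k = 1 \<longrightarrow> V \<omega> holomorphic_on ball 0 \<epsilon> \<and> V \<omega> 0 = wq"
        "\<forall>\<omega>::complex. \<forall>t\<in>ball 0 \<epsilon>. \<omega> ^ k = 1 \<longrightarrow> fst (B (V \<omega> t)) = fst (A (zq + t ^ k))"
        "\<forall>w\<in>ball wq \<delta>. \<forall>t\<in>ball 0 \<epsilon>. fst (B w) = fst (A (zq + t ^ k)) \<longrightarrow>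
           (\<exists>\<omega>::complex. \<omega> ^ k = 1 \<and> w = V \<omega> t)"
      by (rule fibre_parametrization[OF hol(1,3) nc ab])
    define W where "W = V 1"
    have W: "W holomorphic_on ball 0 \<epsilon>" "W 0 = wq"
      "\<And>t. t \<in> ball 0 \<epsilon> \<Longrightarrow> fst (B (W t)) = fst (A (zq + t ^ k))"
      unfolding W_def using V by (simp_all add: V)
    have "isCont W 0" using holomorphic_on_ball_isCont[OF W(1) k(2)] .
    then obtain \<epsilon>1 where \<epsilon>1: "\<epsilon>1 > 0" "\<And>t. dist t 0 < \<epsilon>1 \<Longrightarrow> dist (W t) (W 0) < \<sigma> - cmod wq"
      using ins(2) unfolding continuous_at_eps_delta by (metis diff_gt_0_iff_gt)
    have "continuous (at 0) (\<lambda>t. zq + t ^ k)" by (intro continuous_intros)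
    then obtain \<epsilon>2 where \<epsilon>2: "\<epsilon>2 > 0" "\<And>t. dist t 0 < \<epsilon>2 \<Longrightarrow> dist (zq + t ^ k) (zq + 0 ^ k) < \<rho> - cmod zq"
      using ins(1) unfolding continuous_at_eps_delta by (metis diff_gt_0_iff_gt)
    define e where "e = Min {\<epsilon>, \<epsilon>1, \<epsilon>2}"
    have e: "0 < e" "e \<le> \<epsilon>" "e \<le> \<epsilon>1" "e \<le> \<epsilon>2" unfolding e_def using k \<epsilon>1 \<epsilon>2 by auto
    define f where "f = (\<lambda>t. snd (A (zq + t ^ k)) - snd (B (W t)))"
    have inS: "(zq + t ^ k, W t) \<in> S" if "t \<in> ball 0 e" for t
    proof -
      have "dist (zq + t ^ k) zq < \<rho> - cmod zq" "dist (W t) wq < \<sigma> - cmod wq"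
        using \<epsilon>1(2)[of t] \<epsilon>2(2)[of t] that e W(2) k(1) by (auto simp: power_0_left)
      moreover have "cmod (zq + t ^ k) \<le> cmod zq + dist (zq + t ^ k) zq"
        "cmod (W t) \<le> cmod wq + dist (W t) wq"
        by (metis dist_norm norm_triangle_sub)+
      ultimately show ?thesis using W(3)[of t] that e unfolding S_def by auto
    qed
    have Ff: "F (zq + t ^ k, W t) = cmod (f t)" if "t \<in> ball 0 e" for t
      using inS[OF that] F_snd unfolding S_def f_def by auto
    have f0: "cmod (f 0) = F p0"
      using Ff[of 0] e q(1) W(2) k(1) unfolding M_def zw by (simp add: power_0_left)
    have lower: "cmod (f 0) \<le> cmod (f t)" if "t \<in> ball 0 e" for t
      using p0(2)[OF inS[OF that]] Ff[OF that] f0 by simp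
    have nz: "f t \<noteq> 0" if "t \<in> ball 0 e" for t
      using lower[OF that] f0 ne by (metis dist_norm F_def norm_le_zero_iff norm_eq_zero)
    have "f holomorphic_on ball 0 e"
      unfolding f_def
    proof (intro holomorphic_on_diff)
      have "((\<lambda>z. snd (A z)) \<circ> (\<lambda>t. zq + t ^ k)) holomorphic_on ball 0 e"
        by (rule holomorphic_on_compose_gen[OF _ hol(2)]) (auto intro!: holomorphic_intros)
      then show "(\<lambda>t. snd (A (zq + t ^ k))) holomorphic_on ball 0 e" by (simp add: o_def)
      have "((\<lambda>z. snd (B z)) \<circ> W) holomorphic_on ball 0 e"
        by (rule holomorphic_on_compose_gen[OF _ hol(4)]) (use W(1) e(2) in \<open>auto intro: holomorphic_on_subset\<close>)
      then show "(\<lambda>t. snd (B (W t))) holomorphic_on ball 0 e" by (simp add: o_def)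
    qed
    then have hol1: "(\<lambda>t. 1 / f t) holomorphic_on ball 0 e"
      using nz by (intro holomorphic_intros) auto
    have "(\<lambda>t. 1 / f t) constant_on ball 0 e"
    proof (rule maximum_modulus_principle[OF hol1 open_ball connected_ball open_ball subset_refl])
      show "0 \<in> ball 0 e" using e by simp
      show "cmod (1 / f t) \<le> cmod (1 / f 0)" if "t \<in> ball 0 e" for t
        using lower[OF that] nz[OF that] nz[of 0] e(1) by (simp add: norm_divide divide_simps)
    qed
    then have const: "f t = f 0" if "t \<in> ball 0 e" for t
      using that e(1) unfolding constant_on_def by (metis centre_in_ball div_by_1 divide_divide_eq_right mult_1)
    \<comment> \<open>The branch reaches a parameter further out on the ray through \<open>zq\<close>.\<close>
    define u where "u = (if zq = 0 then 1 else zq / of_real (cmod zq))"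
    have u: "cmod u = 1" "zq = of_real (cmod zq) * u" unfolding u_def by (auto simp: norm_divide)
    obtain t where t: "t ^ k = of_real ((e / 2) ^ k) * u" using complex_nth_root_exists[OF k(1)] by metis
    have "cmod t ^ k = (e / 2) ^ k"
      using arg_cong[OF t, of cmod] u(1) e(1) by (simp add: norm_mult norm_power)
    then have "cmod t = e / 2" using e(1) k(1) by (intro power_eq_imp_eq_base[of "cmod t" k "e/2"]) auto
    then have te: "t \<in> ball 0 e" using e(1) by simp
    have "(zq + t ^ k, W t) \<in> M"
      unfolding M_def using inS[OF te] Ff[OF te] const[OF te] f0 by simp
    then have "cmod (zq + t ^ k) \<le> cmod zq" using q(2) zw by force
    moreover have "zq + t ^ k = of_real (cmod zq + (e / 2) ^ k) * u"
      using u(2) t by (simp add: algebra_simps)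
    then have "cmod (zq + t ^ k) = \<bar>cmod zq + (e / 2) ^ k\<bar> * cmod u" by (metis norm_mult norm_of_real)
    moreover have "(e / 2) ^ k > 0" using e(1) by simp
    ultimately show False using norm_ge_zero[of zq] by (simp only: u(1) mult_1_right)
  qed
  then have "A (fst p0) = B (snd p0)" unfolding F_def by simp
  moreover have "fst p0 \<in> ball 0 \<rho>" "snd p0 \<in> ball 0 \<sigma>" using inside[OF p0(1)] by auto
  ultimately show ?thesis by blast
qed

section \<open>Persistence of isolated intersections\<close>

lemma loc_unif_limit_subseq:
  assumes "loc_unif_limit \<sigma> g" "strict_mono k"
  shows "loc_unif_limit (\<sigma> \<circ> k) g"
  using assms eventually_subseq[OF assms(2)] unfolding loc_unif_limit_def uniform_limit_iff by auto

lemma loc_unif_limit_eventually: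
  assumes "loc_unif_limit \<sigma> g" "0 < e"
  shows "eventually (\<lambda>n. \<forall>z\<in>cball 0 R. dist (\<sigma> n z) (g z) < e) sequentially"
  using assms compact_cball[of "0::complex" R] unfolding loc_unif_limit_def uniform_limit_iff by blast

lemma loc_unif_limit_tendsto:
  assumes "loc_unif_limit \<sigma> g"
  shows "(\<lambda>n. \<sigma> n z) \<longlonglongrightarrow> g z"
proof (rule tendstoI)
  fix e :: real assume "e > 0"
  from loc_unif_limit_eventually[OF assms this, of "cmod z"]
  show "eventually (\<lambda>n. dist (\<sigma> n z) (g z) < e) sequentially"
    by (rule eventually_mono) auto
qed

lemma loc_unif_limit_entire:
  assumes lim: "loc_unif_limit \<sigma> g" and hol: "\<And>n. entire_curve (\<sigma> n)"
  shows "entire_curve g"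
  unfolding entire_curve_def
proof
  have ul: "uniform_limit (cball x 1) \<sigma> g sequentially" for x
    using lim unfolding loc_unif_limit_def by simp
  show "(\<lambda>z. fst (g z)) holomorphic_on UNIV"
  proof (rule holomorphic_uniform_sequence[OF open_UNIV])
    show "(\<lambda>z. fst (\<sigma> n z)) holomorphic_on UNIV" for n using hol unfolding entire_curve_def by blast
    show "\<exists>d>0. cball x d \<subseteq> UNIV \<and> uniform_limit (cball x d) (\<lambda>n z. fst (\<sigma> n z)) (\<lambda>z. fst (g z)) sequentially" for x
      using bounded_linear.uniform_limit[OF bounded_linear_fst ul] by (intro exI[of _ 1]) auto
  qed
  show "(\<lambda>z. snd (g z)) holomorphic_on UNIV"
  proof (rule holomorphic_uniform_sequence[OF open_UNIV])
    show "(\<lambda>z. snd (\<sigma> n z)) holomorphic_on UNIV" for n using hol unfolding entire_curve_def by blast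
    show "\<exists>d>0. cball x d \<subseteq> UNIV \<and> uniform_limit (cball x d) (\<lambda>n z. snd (\<sigma> n z)) (\<lambda>z. snd (g z)) sequentially" for x
      using bounded_linear.uniform_limit[OF bounded_linear_snd ul] by (intro exI[of _ 1]) auto
  qed
qed

lemma zeros_persist:
  assumes Bn: "\<And>n. entire_curve (Bn n)" and Blim: "loc_unif_limit Bn B"
    and An: "(\<lambda>n. an n) \<longlonglongrightarrow> fst (B 0)"
    and \<sigma>: "0 < \<sigma>" and nc: "fst (B w1) \<noteq> fst (B 0)" "w1 \<in> ball 0 \<sigma>"
  shows "eventually (\<lambda>n. \<exists>w\<in>ball 0 \<sigma>. fst (Bn n w) = an n) sequentially"
proof (rule ccontr)
  assume "\<not> ?thesis"
  from not_eventually_sequentiallyD[OF this] obtain k :: "nat \<Rightarrow> nat"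
    where k: "strict_mono k" "\<And>n w. w \<in> ball 0 \<sigma> \<Longrightarrow> fst (Bn (k n) w) \<noteq> an (k n)" by blast
  have "fst (B 0) - fst (B 0) \<noteq> 0"
  proof (rule Hurwitz_no_zeros[of "ball 0 \<sigma>" "\<lambda>n w. fst (Bn (k n) w) - an (k n)" "\<lambda>w. fst (B w) - fst (B 0)"])
    show "(\<lambda>w. fst (Bn (k n) w) - an (k n)) holomorphic_on ball 0 \<sigma>" for n
      using Bn[of "k n"] unfolding entire_curve_def by (intro holomorphic_intros) (auto intro: holomorphic_on_subset)
    show "(\<lambda>w. fst (B w) - fst (B 0)) holomorphic_on ball 0 \<sigma>"
      using loc_unif_limit_entire[OF Blim Bn] unfolding entire_curve_def
      by (intro holomorphic_intros) (auto intro: holomorphic_on_subset)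
    show "\<not> (\<lambda>w. fst (B w) - fst (B 0)) constant_on ball 0 \<sigma>"
    proof
      assume "(\<lambda>w. fst (B w) - fst (B 0)) constant_on ball 0 \<sigma>"
      then obtain c where c: "\<And>w. w \<in> ball 0 \<sigma> \<Longrightarrow> fst (B w) - fst (B 0) = c" unfolding constant_on_def by blast
      show False using c[of w1] c[of 0] nc \<sigma> by simp
    qed
    show "uniform_limit K (\<lambda>n w. fst (Bn (k n) w) - an (k n)) (\<lambda>w. fst (B w) - fst (B 0)) sequentially"
      if "compact K" for K
      unfolding uniform_limit_iff
    proof (intro allI impI)
      fix e :: real assume e: "e > 0"
      have "eventually (\<lambda>n. \<forall>w\<in>K. dist (Bn n w) (B w) < e / 2) sequentially"
        using Blim that half_gt_zero[OF e] unfolding loc_unif_limit_def uniform_limit_iff by blast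
      moreover have "eventually (\<lambda>n. dist (an n) (fst (B 0)) < e / 2) sequentially"
        using tendstoD[OF An half_gt_zero[OF e]] .
      ultimately have "eventually (\<lambda>n. \<forall>w\<in>K. dist (fst (Bn n w) - an n) (fst (B w) - fst (B 0)) < e) sequentially"
      proof eventually_elim
        case (elim n)
        show ?case
        proof
          fix w assume "w \<in> K"
          then have "dist (fst (Bn n w)) (fst (B w)) < e / 2"
            using elim(1) dist_fst_le[of "Bn n w" "B w"] by (meson le_less_trans)
          moreover have eq: "fst (Bn n w) - an n - (fst (B w) - fst (B 0)) =
              (fst (Bn n w) - fst (B w)) - (an n - fst (B 0))" by simp
          ultimately show "dist (fst (Bn n w) - an n) (fst (B w) - fst (B 0)) < e"
            using elim(2) norm_triangle_ineq4[of "fst (Bn n w) - fst (B w)" "an n - fst (B 0)"]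
            unfolding dist_norm eq by linarith
        qed
      qed
      then show "eventually (\<lambda>n. \<forall>w\<in>K. dist (fst (Bn (k n) w) - an (k n)) (fst (B w) - fst (B 0)) < e) sequentially"
        by (rule eventually_subseq[OF k(1)])
    qed
  qed (use k \<sigma> in auto)
  then show False by simp
qed

text \<open>The hypothesis \<open>iso\<close> excludes accumulation of intersection parameters at the origin, by
\<open>accumulating_intersections_coincide\<close>. This yields a bidisc on whose boundary \<open>A z\<close> and \<open>B w\<close> are
uniformly separated, a property inherited by nearby curves; Hurwitz' theorem provides a point of the
perturbed curves with equal first coordinates and small distance, from which
\<open>separated_on_boundary_meet_inside\<close> applies.\<close>
lemma isolated_intersection_persists_fst:
  assumes An: "\<And>n. entire_curve (An n)" and Bn: "\<And>n. entire_curve (Bn n)"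
    and lim: "loc_unif_limit An A" "loc_unif_limit Bn B" and AB: "A 0 = B 0"
    and nc: "fst (B w1) \<noteq> fst (B w2)" and \<epsilon>: "0 < \<epsilon>"
    and iso: "\<not> (\<exists>\<rho>>0. A ` ball 0 \<rho> \<subseteq> B ` ball 0 \<epsilon>)"
  shows "eventually (\<lambda>n. \<exists>z\<in>ball 0 \<epsilon>. \<exists>w\<in>ball 0 \<epsilon>. An n z = Bn n w) sequentially"
proof -
  have A: "entire_curve A" and B: "entire_curve B" using loc_unif_limit_entire An Bn lim by blast+
  have contA: "continuous_on UNIV A" and contB: "continuous_on UNIV B" using entire_curve_continuous A B by auto
  have "\<exists>w3. fst (B w3) \<noteq> fst (B 0)" using nc by metis
  then obtain w3 where w3: "fst (B w3) - fst (B 0) \<noteq> 0" by auto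
  have "(\<lambda>w. fst (B w) - fst (B 0)) holomorphic_on UNIV"
    using B unfolding entire_curve_def by (intro holomorphic_intros) auto
  from isolated_zeros[OF this open_UNIV connected_UNIV _ _ _ w3, of 0] obtain r
    where r: "0 < r" "\<And>w. w \<in> ball 0 r - {0} \<Longrightarrow> fst (B w) - fst (B 0) \<noteq> 0" by auto
  define \<sigma> where "\<sigma> = min r \<epsilon> / 2"
  have \<sigma>: "0 < \<sigma>" "\<sigma> < \<epsilon>" "\<sigma> < r" unfolding \<sigma>_def using r \<epsilon> by auto
  have B0: "w = 0" if "B w = B 0" "cmod w \<le> \<sigma>" for w
    using r(2)[of w] that \<sigma> by auto

  \<comment> \<open>Parameters \<open>w\<close> of intersection points with \<open>z\<close> tending to 0 accumulate only at 0, because \<open>B\<close> takes the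
    value \<open>B 0\<close> in the disc of radius \<open>\<sigma>\<close> at the origin only.\<close>
  have "\<exists>d>0. \<forall>z w. z \<noteq> 0 \<longrightarrow> cmod z < d \<longrightarrow> cmod w \<le> \<sigma> \<longrightarrow> A z \<noteq> B w"
  proof (rule ccontr)
    assume none: "\<not> ?thesis"
    have "\<exists>z w. z \<noteq> 0 \<and> cmod z < 1 / real (Suc n) \<and> cmod w \<le> \<sigma> \<and> A z = B w" for n
      using none by (metis of_nat_0_less_iff zero_less_Suc zero_less_divide_1_iff)
    then obtain z w where zw: "\<And>n. z n \<noteq> 0" "\<And>n. cmod (z n) < 1 / real (Suc n)"
      "\<And>n. cmod (w n) \<le> \<sigma>" "\<And>n. A (z n) = B (w n)" by metis
    have zlim: "z \<longlonglongrightarrow> 0"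
    proof (rule Lim_null_comparison)
      show "(\<lambda>n. 1 / real (Suc n)) \<longlonglongrightarrow> 0" by (rule LIMSEQ_Suc[OF lim_const_over_n])
    qed (use zw(2) in \<open>auto intro!: always_eventually less_imp_le\<close>)
    have "bounded (range w)" unfolding bounded_iff using zw(3) by blast
    then obtain wl k where k: "strict_mono (k :: nat \<Rightarrow> nat)" "(w \<circ> k) \<longlonglongrightarrow> wl"
      using bounded_imp_convergent_subsequence by blast
    have zk: "(z \<circ> k) \<longlonglongrightarrow> 0" by (rule LIMSEQ_subseq_LIMSEQ[OF zlim k(1)])
    have "(\<lambda>n. B ((w \<circ> k) n)) \<longlonglongrightarrow> B wl" by (rule continuous_on_tendsto_compose[OF contB k(2)]) auto
    moreover have "(\<lambda>n. A ((z \<circ> k) n)) \<longlonglongrightarrow> A 0" by (rule continuous_on_tendsto_compose[OF contA zk]) auto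
    ultimately have "B wl = B 0" using LIMSEQ_unique AB by (auto simp: zw(4))
    moreover have "cmod wl \<le> \<sigma>"
      by (rule Lim_bounded[OF tendsto_norm[OF k(2)], of 0]) (use zw(3) in auto)
    ultimately have "wl = 0" by (rule B0)
    then have "\<exists>\<rho>>0. A ` ball 0 \<rho> \<subseteq> B ` ball 0 \<epsilon>"
      using k(2) zw \<epsilon>
      by (intro accumulating_intersections_coincide[OF A B nc AB zk, where w = "w \<circ> k"]) auto
    then show False using iso by blast
  qed
  then obtain d where d: "d > 0" "\<And>z w. z \<noteq> 0 \<Longrightarrow> cmod z < d \<Longrightarrow> cmod w \<le> \<sigma> \<Longrightarrow> A z \<noteq> B w" by blast
  define \<rho> where "\<rho> = min d \<epsilon> / 2"
  have \<rho>: "0 < \<rho>" "\<rho> < \<epsilon>" "\<rho> < d" unfolding \<rho>_def using d \<epsilon> by auto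

  define K where "K = sphere (0::complex) \<rho> \<times> cball (0::complex) \<sigma> \<union> cball 0 \<rho> \<times> sphere 0 \<sigma>"
  have cK: "compact K" unfolding K_def by (intro compact_Un compact_Times) auto
  have "(of_real \<rho>, 0) \<in> K" using \<rho> \<sigma> unfolding K_def by simp
  then have neK: "K \<noteq> {}" by blast
  have contF: "continuous_on K (\<lambda>p. dist (A (fst p)) (B (snd p)))"
    by (intro continuous_on_dist continuous_on_compose2[OF contA] continuous_on_compose2[OF contB] continuous_intros) auto
  from continuous_attains_inf[OF cK neK contF] obtain p0 where p0: "p0 \<in> K"
    "\<And>p. p \<in> K \<Longrightarrow> dist (A (fst p0)) (B (snd p0)) \<le> dist (A (fst p)) (B (snd p))" by metis
  define \<eta> where "\<eta> = dist (A (fst p0)) (B (snd p0)) / 3"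
  have "A (fst p0) \<noteq> B (snd p0)"
  proof (cases "fst p0 = 0")
    case True
    then have "cmod (snd p0) = \<sigma>" using p0(1) \<rho>(1) unfolding K_def by (auto simp: mem_Times_iff)
    then have "B (snd p0) \<noteq> B 0" using B0[of "snd p0"] \<sigma>(1) by fastforce
    then show ?thesis unfolding True AB by (rule not_sym)
  next
    case False
    then show ?thesis using p0(1) \<rho> by (intro d(2)) (auto simp: K_def mem_Times_iff)
  qed
  then have \<eta>: "\<eta> > 0" unfolding \<eta>_def by simp
  have sep: "3 * \<eta> \<le> dist (A z) (B w)" if "(z, w) \<in> K" for z w
    using p0(2)[OF that] unfolding \<eta>_def by simp

  have "isCont B 0" using contB by (simp add: continuous_on_eq_continuous_at)
  then obtain s where s: "s > 0" "\<And>w. dist w 0 < s \<Longrightarrow> dist (B w) (B 0) < \<eta> / 4"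
    using \<eta> unfolding continuous_at_eps_delta by (metis divide_pos_pos zero_less_numeral)
  define \<tau> where "\<tau> = min s \<sigma>"
  have \<tau>: "0 < \<tau>" "\<tau> \<le> s" "\<tau> \<le> \<sigma>" unfolding \<tau>_def using s \<sigma> by auto
  have ev0: "eventually (\<lambda>n. \<exists>w\<in>ball 0 \<tau>. fst (Bn n w) = fst (An n 0)) sequentially"
  proof (rule zeros_persist[OF Bn lim(2) _ \<tau>(1)])
    show "(\<lambda>n. fst (An n 0)) \<longlonglongrightarrow> fst (B 0)"
      using tendsto_fst[OF loc_unif_limit_tendsto[OF lim(1), of 0]] AB by simp
    show "fst (B (of_real (\<tau> / 2))) \<noteq> fst (B 0)" using r(2)[of "of_real (\<tau> / 2)"] \<tau> \<sigma> by auto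
    show "of_real (\<tau> / 2) \<in> ball (0::complex) \<tau>" using \<tau> by simp
  qed
  have evA: "eventually (\<lambda>n. \<forall>z\<in>cball 0 \<rho>. dist (An n z) (A z) < \<eta> / 4) sequentially"
    and evB: "eventually (\<lambda>n. \<forall>z\<in>cball 0 \<sigma>. dist (Bn n z) (B z) < \<eta> / 4) sequentially"
    by (rule loc_unif_limit_eventually[OF lim(1)] loc_unif_limit_eventually[OF lim(2)]; use \<eta> in simp)+
  have "(\<lambda>n. fst (Bn n w1) - fst (Bn n w2)) \<longlonglongrightarrow> fst (B w1) - fst (B w2)"
    by (intro tendsto_diff tendsto_fst loc_unif_limit_tendsto lim)
  then have evN: "eventually (\<lambda>n. fst (Bn n w1) - fst (Bn n w2) \<noteq> 0) sequentially"
    by (rule tendsto_imp_eventually_ne) (use nc in auto)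
  show ?thesis
    using ev0 evA evB evN
  proof eventually_elim
    case (elim n)
    obtain w0 where w0: "cmod w0 < \<tau>" "fst (Bn n w0) = fst (An n 0)" using elim(1) by auto
    have key: "\<eta> \<le> dist (An n z) (Bn n w)" if "(z, w) \<in> K" for z w
    proof -
      have zw: "z \<in> cball 0 \<rho>" "w \<in> cball 0 \<sigma>" using that unfolding K_def by auto
      have "dist (A z) (B w) \<le> dist (An n z) (A z) + dist (An n z) (Bn n w) + dist (Bn n w) (B w)"
        using dist_triangle[of "A z" "B w" "An n z"] dist_triangle[of "An n z" "B w" "Bn n w"]
          dist_commute[of "A z" "An n z"] by linarith
      moreover have "dist (An n z) (A z) < \<eta> / 4" "dist (Bn n w) (B w) < \<eta> / 4" using elim zw by auto
      ultimately show ?thesis using sep[OF that] \<eta> by linarith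
    qed
    have "\<exists>z\<in>ball 0 \<rho>. \<exists>w\<in>ball 0 \<sigma>. An n z = Bn n w"
    proof (rule separated_on_boundary_meet_inside[OF An Bn _ \<rho>(1) \<sigma>(1), where \<eta> = \<eta> and ?w0.0 = w0])
      show "fst (Bn n w1) \<noteq> fst (Bn n w2)" using elim(4) by simp
      show "\<eta> \<le> dist (An n z) (Bn n w)" if "cmod z = \<rho>" "cmod w \<le> \<sigma>" for z w
        by (rule key) (use that in \<open>auto simp: K_def\<close>)
      show "\<eta> \<le> dist (An n z) (Bn n w)" if "cmod z \<le> \<rho>" "cmod w = \<sigma>" for z w
        by (rule key) (use that in \<open>auto simp: K_def\<close>)
      show "cmod w0 \<le> \<sigma>" using w0(1) \<tau> by simp
      show "fst (An n 0) = fst (Bn n w0)" using w0(2) by simp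
      have "dist (An n 0) (A 0) < \<eta> / 4" "dist (Bn n w0) (B w0) < \<eta> / 4" "dist (B w0) (B 0) < \<eta> / 4"
        using elim(2,3) w0(1) \<tau> \<rho>(1) s(2)[of w0] by auto
      moreover have "dist (An n 0) (Bn n w0) \<le> dist (An n 0) (A 0) + (dist (B w0) (B 0) + dist (Bn n w0) (B w0))"
        using dist_triangle[of "An n 0" "Bn n w0" "A 0"] dist_triangle[of "B 0" "Bn n w0" "B w0"] AB
        by (simp add: dist_commute)
      ultimately show "dist (An n 0) (Bn n w0) < \<eta>" using \<eta> by linarith
    qed
    then show "\<exists>z\<in>ball 0 \<epsilon>. \<exists>w\<in>ball 0 \<epsilon>. An n z = Bn n w" using \<rho> \<sigma> by (meson subset_ball less_imp_le subsetD)
  qed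
qed

text \<open>One of the coordinates is not constant along \<open>B\<close>; after exchanging the coordinates it is the first. The
hypothesis \<open>iso\<close> compares images of discs because limits of injective immersions need be neither injective
nor immersed.\<close>
proposition isolated_intersection_persists:
  assumes An: "\<And>n. entire_curve (An n)" and Bn: "\<And>n. entire_curve (Bn n)"
    and lim: "loc_unif_limit An A" "loc_unif_limit Bn B" and AB: "A 0 = B 0"
    and nc: "B w1 \<noteq> B w2" and \<epsilon>: "0 < \<epsilon>"
    and iso: "\<not> (\<exists>\<rho>>0. A ` ball 0 \<rho> \<subseteq> B ` ball 0 \<epsilon>)"
  shows "eventually (\<lambda>n. \<exists>z\<in>ball 0 \<epsilon>. \<exists>w\<in>ball 0 \<epsilon>. An n z = Bn n w) sequentially"
proof (cases "fst (B w1) = fst (B w2)")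
  case False
  then show ?thesis by (rule isolated_intersection_persists_fst[OF An Bn lim AB _ \<epsilon> iso])
next
  case True
  have ds: "dist (prod.swap p) (prod.swap q) = dist p q" for p q :: C2
    by (simp add: dist_prod_def add.commute)
  have lim': "loc_unif_limit (\<lambda>n z. prod.swap (\<sigma> n z)) (\<lambda>z. prod.swap (g z))" if "loc_unif_limit \<sigma> g" for \<sigma> g
    using that unfolding loc_unif_limit_def uniform_limit_iff by (simp add: ds)
  have sub: "(\<lambda>z. prod.swap (A z)) ` ball 0 \<rho> \<subseteq> (\<lambda>z. prod.swap (B z)) ` ball 0 \<epsilon> \<Longrightarrow>
      A ` ball 0 \<rho> \<subseteq> B ` ball 0 \<epsilon>" for \<rho>
    by (smt (verit, best) image_iff image_subset_iff swap_swap)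
  have "eventually (\<lambda>n. \<exists>z\<in>ball 0 \<epsilon>. \<exists>w\<in>ball 0 \<epsilon>. prod.swap (An n z) = prod.swap (Bn n w)) sequentially"
  proof (rule isolated_intersection_persists_fst[OF _ _ lim'[OF lim(1)] lim'[OF lim(2)] _ _ \<epsilon>])
    show "entire_curve (\<lambda>z. prod.swap (An n z))" "entire_curve (\<lambda>z. prod.swap (Bn n z))" for n
      using An Bn unfolding entire_curve_def by auto
    show "fst (prod.swap (B w1)) \<noteq> fst (prod.swap (B w2))" using nc True by (simp add: prod_eq_iff)
    show "\<not> (\<exists>\<rho>>0. (\<lambda>z. prod.swap (A z)) ` ball 0 \<rho> \<subseteq> (\<lambda>z. prod.swap (B z)) ` ball 0 \<epsilon>)"
      using iso sub by blast
  qed (use AB in simp)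
  then show ?thesis by (rule eventually_mono) (metis swap_swap)
qed

section \<open>Expansion along normal families of unstable curves\<close>

lemma loc_unif_limit_tendsto_diagonal:
  assumes lim: "loc_unif_limit \<sigma> g" and g: "continuous_on UNIV g" and z: "z \<longlonglongrightarrow> z0"
  shows "(\<lambda>n. \<sigma> n (z n)) \<longlonglongrightarrow> g z0"
proof (rule tendstoI)
  fix e :: real assume e: "e > 0"
  have "(\<lambda>n. g (z n)) \<longlonglongrightarrow> g z0" by (rule continuous_on_tendsto_compose[OF g z]) auto
  then have "eventually (\<lambda>n. dist (g (z n)) (g z0) < e / 2) sequentially"
    using e by (intro tendstoD) auto
  moreover have "eventually (\<lambda>n. dist (z n) z0 < 1) sequentially" by (rule tendstoD[OF z]) simp
  moreover have "eventually (\<lambda>n. \<forall>z\<in>cball 0 (cmod z0 + 1). dist (\<sigma> n z) (g z) < e / 2) sequentially"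
    using e by (intro loc_unif_limit_eventually[OF lim]) simp
  ultimately show "eventually (\<lambda>n. dist (\<sigma> n (z n)) (g z0) < e) sequentially"
  proof eventually_elim
    case (elim n)
    have "cmod (z n) \<le> cmod z0 + 1"
      using elim(2) norm_triangle_sub[of "z n" z0] by (simp add: dist_norm)
    then have "dist (\<sigma> n (z n)) (g (z n)) < e / 2" using elim(3) by simp
    then show ?case using elim(1) dist_triangle[of "\<sigma> n (z n)" "g z0" "g (z n)"] by linarith
  qed
qed

lemma ball_subset_param_domain:
  assumes "0 < e" "\<And>z. z \<in> ball 0 e \<Longrightarrow> dist (\<psi> z) (\<psi> 0) < r"
  shows "ball 0 e \<subseteq> param_domain \<psi> r"
  unfolding param_domain_def
  by (rule connected_component_maximal) (use assms in \<open>auto simp: dist_commute\<close>)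

lemma uniformly_continuous_near_compact:
  fixes f :: "'a::euclidean_space \<Rightarrow> 'b::metric_space"
  assumes "continuous_on UNIV f" "compact X" "0 < e"
  shows "\<exists>d>0. \<forall>x\<in>X. \<forall>p. dist p x < d \<longrightarrow> dist (f p) (f x) < e"
proof -
  obtain B where B: "\<And>x. x \<in> X \<Longrightarrow> norm x \<le> B"
    using compact_imp_bounded[OF assms(2)] unfolding bounded_iff by metis
  have "uniformly_continuous_on (cball 0 (B + 1)) f"
    using assms(1) by (intro compact_uniformly_continuous) (auto intro: continuous_on_subset)
  then obtain d where d: "d > 0" "\<And>x p. x \<in> cball 0 (B + 1) \<Longrightarrow> p \<in> cball 0 (B + 1) \<Longrightarrow>
      dist p x < d \<Longrightarrow> dist (f p) (f x) < e"
    unfolding uniformly_continuous_on_def using assms(3) by metis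
  show ?thesis
  proof (intro exI conjI ballI allI impI)
    show "min d 1 > 0" using d(1) by simp
    fix x p assume x: "x \<in> X" and p: "dist p x < min d 1"
    have "norm p \<le> norm x + dist p x" by (metis dist_norm norm_triangle_sub)
    then show "dist (f p) (f x) < e" using B[OF x] p by (intro d(2)) auto
  qed
qed

text \<open>The setting is symmetric in time: it is satisfied by a Henon map with its unstable curves and by its
inverse with the stable ones. The closed set \<open>Q\<close> stands for the closure of the set of points with
bounded backward orbit; what matters is that points of \<open>Q\<close> with bounded forward orbit form a bounded set.\<close>
locale unstable_family =
  fixes f :: "C2 \<Rightarrow> C2" and X :: "C2 set" and \<psi> :: "C2 \<Rightarrow> complex \<Rightarrow> C2"
    and Q :: "C2 set" and R :: real
  assumes bij: "bij f" and cont: "continuous_on UNIV f" and cont_inv: "continuous_on UNIV (inv f)"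
    and entire: "preserves_entire f"
    and X: "compact X" "f ` X = X"
    and immersion: "x \<in> X \<Longrightarrow> injective_holomorphic_immersion (\<psi> x)"
    and centre: "x \<in> X \<Longrightarrow> \<psi> x 0 = x"
    and invariant: "x \<in> X \<Longrightarrow> f ` range (\<psi> x) = range (\<psi> (f x))"
    and range_Q: "x \<in> X \<Longrightarrow> range (\<psi> x) \<subseteq> Q"
    and Q: "closed Q" "bounded (K_plus f \<inter> Q)"
    and normal: "normal_family (\<psi> ` X)"
    and R: "admissible_radius (\<psi> ` X) R"
begin

lemma R_pos: "R > 0" using R unfolding admissible_radius_def by blast

lemma entire_member: "x \<in> X \<Longrightarrow> entire_curve (\<psi> x)"
  using immersion immersion_entire_curve by blast

lemma f_X: "x \<in> X \<Longrightarrow> f x \<in> X" using X(2) by blast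

lemma iterate_X: "x \<in> X \<Longrightarrow> (f ^^ n) x \<in> X" by (induction n) (auto intro: f_X)

lemma inv_X: "x \<in> X \<Longrightarrow> inv f x \<in> X"
  using X(2) bij by (metis bij_inv_eq_iff image_iff)

lemma inv_iterate_X: "x \<in> X \<Longrightarrow> (inv f ^^ n) x \<in> X" by (induction n) (auto intro: inv_X)

lemma iterate_inv_iterate: "(f ^^ n) ((inv f ^^ n) p) = p"
proof (induction n arbitrary: p)
  case (Suc n)
  have "(f ^^ Suc n) ((inv f ^^ Suc n) p) = f ((f ^^ n) ((inv f ^^ n) (inv f p)))"
    by (simp add: funpow_swap1)
  then show ?case using Suc bij by (simp add: bij_is_surj surj_f_inv_f)
qed simp

lemma inv_iterate_iterate: "(inv f ^^ n) ((f ^^ n) p) = p"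
proof (induction n arbitrary: p)
  case (Suc n)
  have "(inv f ^^ Suc n) ((f ^^ Suc n) p) = inv f ((inv f ^^ n) ((f ^^ n) (f p)))"
    by (simp add: funpow_swap1)
  then show ?case using Suc bij by (simp add: bij_is_inj inv_f_f)
qed simp

lemma iterate_cont: "continuous_on UNIV (f ^^ n)"
proof (induction n)
  case (Suc n)
  show ?case unfolding funpow.simps o_def by (rule continuous_on_compose2[OF cont Suc]) simp
qed (simp add: id_def)

lemma inv_iterate_cont: "continuous_on UNIV (inv f ^^ n)"
proof (induction n)
  case (Suc n)
  show ?case unfolding funpow.simps o_def by (rule continuous_on_compose2[OF cont_inv Suc]) simp
qed (simp add: id_def)

text \<open>Both \<open>f \<circ> \<psi> x\<close> and \<open>\<psi> (f x)\<close> parametrize the same curve injectively, hence they differ by an entire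
bijection of the plane, which fixes the origin.\<close>
lemma linear_conjugacy:
  assumes x: "x \<in> X"
  shows "\<exists>l. l \<noteq> 0 \<and> (\<forall>z. f (\<psi> x z) = \<psi> (f x) (l * z))"
proof -
  have inj: "inj (\<lambda>z. f (\<psi> x z))"
    using immersion[OF x] bij unfolding injective_holomorphic_immersion_def
    by (auto simp: inj_def bij_is_inj[THEN inj_eq])
  have ent: "entire_curve (\<lambda>z. f (\<psi> x z))"
    using entire entire_member[OF x] unfolding preserves_entire_def by blast
  have "range (\<lambda>z. f (\<psi> x z)) = range (\<psi> (f x))" using invariant[OF x] by (simp add: image_image)
  from same_image_reparametrization[OF immersion[OF f_X[OF x]] inj ent this]
  obtain h where h: "h holomorphic_on UNIV" "bij h" "\<And>z. f (\<psi> x z) = \<psi> (f x) (h z)" by metis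
  have "\<psi> (f x) (h 0) = \<psi> (f x) 0" using h(3)[of 0] centre[OF x] centre[OF f_X[OF x]] by simp
  then have "h 0 = 0"
    using immersion[OF f_X[OF x]] unfolding injective_holomorphic_immersion_def by (simp add: inj_eq)
  then obtain l where "l \<noteq> 0" "\<And>z. h z = l * z" using entire_bijection_linear[OF h(1,2)] by metis
  then show ?thesis using h(3) by auto
qed

definition multiplier :: "C2 \<Rightarrow> complex" where
  "multiplier x = (SOME l. l \<noteq> 0 \<and> (\<forall>z. f (\<psi> x z) = \<psi> (f x) (l * z)))"

lemma multiplier:
  assumes "x \<in> X"
  shows "multiplier x \<noteq> 0" "f (\<psi> x z) = \<psi> (f x) (multiplier x * z)"
  using someI_ex[OF linear_conjugacy[OF assms]] unfolding multiplier_def by blast+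

fun cocycle :: "nat \<Rightarrow> C2 \<Rightarrow> complex" where
  "cocycle 0 x = 1"
| "cocycle (Suc n) x = multiplier ((f ^^ n) x) * cocycle n x"

lemma cocycle_nonzero: "x \<in> X \<Longrightarrow> cocycle n x \<noteq> 0"
  by (induction n) (auto simp: multiplier(1) iterate_X)

lemma iterate_conjugacy: "x \<in> X \<Longrightarrow> (f ^^ n) (\<psi> x z) = \<psi> ((f ^^ n) x) (cocycle n x * z)"
  by (induction n) (auto simp: multiplier(2) iterate_X mult.assoc)

lemma cocycle_add: "cocycle (m + n) x = cocycle m ((f ^^ n) x) * cocycle n x"
  by (induction m) (auto simp: funpow_add)

lemma convergent_subfamily:
  assumes "\<And>n::nat. x n \<in> X"
  obtains k g where "strict_mono k" "loc_unif_limit (\<lambda>n. \<psi> (x (k n))) g"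
proof -
  have "range (\<lambda>n. \<psi> (x n)) \<subseteq> \<psi> ` X" using assms by auto
  then obtain k g where "strict_mono (k :: nat \<Rightarrow> nat)" "loc_unif_limit ((\<lambda>n. \<psi> (x n)) \<circ> k) g"
    using normal unfolding normal_family_def by meson
  then show ?thesis using that by (simp add: o_def)
qed

text \<open>A normal family of curves with finite limits is locally bounded, because each of its locally uniform
limits is bounded on the disc.\<close>
lemma uniform_bound: "\<exists>C. \<forall>x\<in>X. \<forall>z\<in>cball 0 \<rho>. norm (\<psi> x z) \<le> C"
proof (rule ccontr)
  assume none: "\<not> ?thesis"
  have "\<exists>x z. x \<in> X \<and> z \<in> cball 0 \<rho> \<and> norm (\<psi> x z) > real n" for n :: nat
  proof -
    have "\<not> (\<forall>x\<in>X. \<forall>z\<in>cball 0 \<rho>. norm (\<psi> x z) \<le> real n)" using none by blast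
    then show ?thesis by (meson not_le)
  qed
  then obtain x z where xz: "\<And>n. x n \<in> X" "\<And>n. z n \<in> cball 0 \<rho>" "\<And>n. norm (\<psi> (x n) (z n)) > real n" by metis
  obtain k g where k: "strict_mono k" "loc_unif_limit (\<lambda>n. \<psi> (x (k n))) g"
    using convergent_subfamily[of x, OF xz(1)] by metis
  have g: "entire_curve g" by (rule loc_unif_limit_entire[OF k(2)]) (simp add: entire_member xz(1))
  have "compact (g ` cball 0 \<rho>)"
    by (intro compact_continuous_image entire_curve_continuous g compact_cball)
  then have "bounded (g ` cball 0 \<rho>)" by (rule compact_imp_bounded)
  then obtain C where C: "\<And>z. z \<in> cball 0 \<rho> \<Longrightarrow> norm (g z) \<le> C"
    unfolding bounded_iff by blast
  obtain N where N: "\<And>n. n \<ge> N \<Longrightarrow> \<forall>z\<in>cball 0 \<rho>. dist (\<psi> (x (k n)) z) (g z) < 1"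
    using loc_unif_limit_eventually[OF k(2), of 1 \<rho>] unfolding eventually_sequentially by auto
  obtain M :: nat where M: "C + 1 < real M" using reals_Archimedean2 by blast
  let ?n = "max N M"
  have "norm (\<psi> (x (k ?n)) (z (k ?n))) \<le> norm (g (z (k ?n))) + dist (\<psi> (x (k ?n)) (z (k ?n))) (g (z (k ?n)))"
    by (metis dist_norm norm_triangle_sub)
  also have "\<dots> < C + 1" using C[OF xz(2)[of "k ?n"]] N[of ?n] xz(2)[of "k ?n"] by fastforce
  also have "\<dots> < real (k ?n)" using M seq_suble[OF k(1), of ?n] by linarith
  finally show False using xz(3)[of "k ?n"] by simp
qed

lemma equicontinuous_at_centre:
  assumes "0 < e"
  shows "\<exists>d>0. \<forall>x\<in>X. \<forall>z\<in>cball 0 d. dist (\<psi> x z) x < e"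
proof (rule ccontr)
  assume none: "\<not> ?thesis"
  have "\<exists>x z. x \<in> X \<and> z \<in> cball 0 (1 / real (Suc n)) \<and> e \<le> dist (\<psi> x z) x" for n
  proof -
    have "1 / real (Suc n) > 0" by simp
    then have "\<not> (\<forall>x\<in>X. \<forall>z\<in>cball 0 (1 / real (Suc n)). dist (\<psi> x z) x < e)" using none by blast
    then show ?thesis by (meson not_less)
  qed
  then obtain x z where xz: "\<And>n. x n \<in> X" "\<And>n. z n \<in> cball 0 (1 / real (Suc n))"
    "\<And>n. e \<le> dist (\<psi> (x n) (z n)) (x n)" by metis
  obtain k g where k: "strict_mono k" "loc_unif_limit (\<lambda>n. \<psi> (x (k n))) g"
    using convergent_subfamily[of x, OF xz(1)] by metis
  have g: "entire_curve g" by (rule loc_unif_limit_entire[OF k(2)]) (simp add: entire_member xz(1))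
  have "z \<longlonglongrightarrow> 0"
  proof (rule Lim_null_comparison)
    show "(\<lambda>n. 1 / real (Suc n)) \<longlonglongrightarrow> 0" by (rule LIMSEQ_Suc[OF lim_const_over_n])
  qed (use xz(2) in \<open>auto intro!: always_eventually\<close>)
  then have "(z \<circ> k) \<longlonglongrightarrow> 0" by (rule LIMSEQ_subseq_LIMSEQ[OF _ k(1)])
  from loc_unif_limit_tendsto_diagonal[OF k(2) entire_curve_continuous[OF g] this]
  have "(\<lambda>n. \<psi> (x (k n)) (z (k n))) \<longlonglongrightarrow> g 0" by simp
  moreover have "(\<lambda>n. x (k n)) \<longlonglongrightarrow> g 0"
    using loc_unif_limit_tendsto[OF k(2), of 0] by (simp add: centre xz(1))
  ultimately have "(\<lambda>n. dist (\<psi> (x (k n)) (z (k n))) (x (k n))) \<longlonglongrightarrow> dist (g 0) (g 0)"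
    by (rule tendsto_dist)
  then have "e \<le> dist (g 0) (g 0)"
    by (rule Lim_bounded2[where N = 0]) (use xz(3) in auto)
  then show False using assms by simp
qed

text \<open>If a disc of parameters were mapped into the ball of radius \<open>R\<close>, it would lie in the parameter domain,
which is contained in a disc of radius independent of \<open>x\<close>.\<close>
lemma discs_leave_ball:
  obtains \<rho>o where "0 < \<rho>o" "\<forall>x\<in>X. \<exists>z\<in>cball 0 \<rho>o. R \<le> dist (\<psi> x z) x"
proof -
  obtain \<rho> where \<rho>: "\<And>g. g \<in> family_hat (\<psi> ` X) \<Longrightarrow> param_domain g R \<subseteq> ball 0 \<rho>"
    using R unfolding admissible_radius_def by blast
  show ?thesis
  proof (rule that[of "max \<rho> 1"]; (intro ballI)?)
    fix x assume x: "x \<in> X"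
    have "\<psi> x \<in> family_hat (\<psi> ` X)"
      unfolding family_hat_def loc_unif_limit_def
      using x by (intro CollectI exI[of _ "\<lambda>_. \<psi> x"]) (auto intro: uniform_limit_const)
    then have sub: "param_domain (\<psi> x) R \<subseteq> ball 0 \<rho>" by (rule \<rho>)
    show "\<exists>z\<in>cball 0 (max \<rho> 1). R \<le> dist (\<psi> x z) x"
    proof (rule ccontr)
      assume "\<not> ?thesis"
      then have in_ball: "\<psi> x z \<in> ball (\<psi> x 0) R" if "z \<in> cball 0 (max \<rho> 1)" for z
        using that x by (auto simp: centre dist_commute not_le)
      have "cball 0 (max \<rho> 1) \<subseteq> param_domain (\<psi> x) R"
        unfolding param_domain_def by (rule connected_component_maximal) (use in_ball in auto)
      moreover have "of_real (max \<rho> 1) \<in> cball (0::complex) (max \<rho> 1)" by simp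
      ultimately have "of_real (max \<rho> 1) \<in> ball (0::complex) \<rho>" using sub by blast
      then show False by simp
    qed
  qed simp
qed

lemma limit_nonconstant:
  assumes x: "\<And>n. x n \<in> X" and lim: "loc_unif_limit (\<lambda>n. \<psi> (x n)) g"
  shows "\<exists>w. g w \<noteq> g 0"
proof (rule ccontr)
  assume "\<not> ?thesis"
  then have c: "g w = g 0" for w by blast
  have "g w \<in> ball (g 0) R" for w unfolding c[of w] using R_pos by simp
  then have "g -` ball (g 0) R = UNIV" by blast
  then have "param_domain g R = UNIV"
    unfolding param_domain_def using connected_component_eq_self[OF connected_UNIV, of "0::complex"] by simp
  moreover have "g \<in> family_hat (\<psi> ` X)"
    unfolding family_hat_def using lim x by (intro CollectI exI[of _ "\<lambda>n. \<psi> (x n)"]) auto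
  ultimately obtain \<rho> where "UNIV \<subseteq> ball (0::complex) \<rho>" using R unfolding admissible_radius_def by metis
  then have "of_real \<bar>\<rho>\<bar> \<in> ball (0::complex) \<rho>" by blast
  then show False by simp
qed

text \<open>A small multiplier would make \<open>f\<close> contract a disc of fixed size around \<open>x\<close> almost to a point; applying the
inverse of \<open>f\<close>, which is uniformly continuous near \<open>X\<close>, keeps the disc inside the ball of radius \<open>R\<close>, which it has to leave.\<close>
lemma multiplier_bounded_below:
  obtains c where "0 < c" "c \<le> 1" "\<forall>x\<in>X. c \<le> cmod (multiplier x)"
proof -
  obtain \<rho> where \<rho> [rule_format]: "0 < \<rho>" "\<forall>x\<in>X. \<exists>z\<in>cball 0 \<rho>. R \<le> dist (\<psi> x z) x" by (rule discs_leave_ball)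
  obtain e where e: "e > 0" "\<And>x p. x \<in> X \<Longrightarrow> dist p x < e \<Longrightarrow> dist (inv f p) (inv f x) < R"
    using uniformly_continuous_near_compact[OF cont_inv X(1) R_pos] by metis
  obtain d where d: "d > 0" "\<And>x z. x \<in> X \<Longrightarrow> cmod z \<le> d \<Longrightarrow> dist (\<psi> x z) x < e"
    using equicontinuous_at_centre[OF e(1)] by (metis mem_cball_0)
  show ?thesis
  proof (rule that[of "min 1 (d / \<rho>)"]; (intro ballI)?)
    fix x assume x: "x \<in> X"
    obtain z where z: "cmod z \<le> \<rho>" "R \<le> dist (\<psi> x z) x" using \<rho>(2)[OF x] by auto
    have inv: "inv f (f p) = p" for p using bij by (simp add: bij_is_inj)
    have "\<not> dist (f (\<psi> x z)) (f x) < e"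
    proof
      assume "dist (f (\<psi> x z)) (f x) < e"
      then have "dist (inv f (f (\<psi> x z))) (inv f (f x)) < R" by (rule e(2)[OF f_X[OF x]])
      then show False using z(2) by (simp add: inv)
    qed
    then have "\<not> cmod (multiplier x * z) \<le> d"
      unfolding multiplier(2)[OF x] using d(2)[OF f_X[OF x]] by blast
    then have "d < cmod (multiplier x) * cmod z" by (simp add: norm_mult)
    also have "\<dots> \<le> cmod (multiplier x) * \<rho>" using z(1) by (intro mult_left_mono) auto
    finally have "d / \<rho> \<le> cmod (multiplier x)" using \<rho>(1) by (simp add: divide_simps)
    then show "min 1 (d / \<rho>) \<le> cmod (multiplier x)" by simp
  qed (use d \<rho> in auto)
qed

text \<open>Otherwise there are points along whose orbits the cocycle stays below 2 for an arbitrarily long time. In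
the limit one gets an entire curve all of whose points have bounded forward orbit, since the iterates of
a disc of radius \<open>cmod z\<close> stay in the images of discs of radius \<open>2 * cmod z\<close>. As the curve also lies in
\<open>Q\<close>, it is bounded, hence constant by Liouville's theorem; but limits of the family are not constant.\<close>
lemma cocycle_doubles:
  obtains N where "\<forall>x\<in>X. \<exists>n\<in>{1..N}. 2 \<le> cmod (cocycle n x)"
proof -
  have "\<exists>N. \<forall>x\<in>X. \<exists>n\<in>{1..N}. 2 \<le> cmod (cocycle n x)"
  proof (rule ccontr)
    assume none: "\<not> ?thesis"
    have "\<exists>x. x \<in> X \<and> (\<forall>n\<le>N. cmod (cocycle n x) \<le> 2)" for N
    proof -
      obtain x where x: "x \<in> X" "\<And>n. n \<in> {1..N} \<Longrightarrow> \<not> 2 \<le> cmod (cocycle n x)" using none by blast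
      have "cmod (cocycle n x) \<le> 2" if "n \<le> N" for n
        using x(2)[of n] that by (cases n) auto
      then show ?thesis using x(1) by blast
    qed
    then obtain x where x: "\<And>N. x N \<in> X" "\<And>N n. n \<le> N \<Longrightarrow> cmod (cocycle n (x N)) \<le> 2" by metis
    obtain k g where k: "strict_mono k" "loc_unif_limit (\<lambda>n. \<psi> (x (k n))) g"
      using convergent_subfamily[of x, OF x(1)] by metis
    have g: "entire_curve g" by (rule loc_unif_limit_entire[OF k(2)]) (simp add: entire_member x(1))
    have "g z \<in> K_plus f" for z
    proof -
      obtain C where C: "\<And>y w. y \<in> X \<Longrightarrow> cmod w \<le> 2 * cmod z \<Longrightarrow> norm (\<psi> y w) \<le> C"
        using uniform_bound[of "2 * cmod z"] mem_cball_0 by metis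
      have "norm ((f ^^ n) (g z)) \<le> C" for n
      proof (rule Lim_bounded)
        show "(\<lambda>m. norm ((f ^^ n) (\<psi> (x (k m)) z))) \<longlonglongrightarrow> norm ((f ^^ n) (g z))"
          by (intro tendsto_norm continuous_on_tendsto_compose[OF iterate_cont] loc_unif_limit_tendsto[OF k(2)]) auto
        show "\<forall>m\<ge>n. norm ((f ^^ n) (\<psi> (x (k m)) z)) \<le> C"
        proof (intro allI impI)
          fix m assume "n \<le> m"
          then have "cmod (cocycle n (x (k m))) \<le> 2" using seq_suble[OF k(1), of m] by (intro x(2)) linarith
          then have "cmod (cocycle n (x (k m)) * z) \<le> 2 * cmod z"
            unfolding norm_mult by (intro mult_right_mono) auto
          then show "norm ((f ^^ n) (\<psi> (x (k m)) z)) \<le> C"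
            unfolding iterate_conjugacy[OF x(1)] by (intro C iterate_X x(1))
        qed
      qed
      then show ?thesis unfolding K_plus_def bounded_iff by auto
    qed
    moreover have "g z \<in> Q" for z
      by (rule closed_sequentially[OF Q(1) _ loc_unif_limit_tendsto[OF k(2), of z]])
         (use range_Q x(1) in blast)
    ultimately have "range g \<subseteq> K_plus f \<inter> Q" by blast
    then have "bounded (range g)" using Q(2) bounded_subset by blast
    then have "g w = g 0" for w using bounded_entire_curve_constant[OF g] by blast
    then show False using limit_nonconstant[OF _ k(2)] x(1) by blast
  qed
  then show ?thesis using that by blast
qed

text \<open>Doubling within every \<open>N\<close> steps is iterated; the incomplete last block costs at most the factor \<open>c ^ N\<close>.\<close>
lemma cocycle_tends_to_infinity:
  obtains n0 where "\<forall>n\<ge>n0. \<forall>x\<in>X. M \<le> cmod (cocycle n x)"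
proof -
  obtain c where c [rule_format]: "0 < c" "c \<le> 1" "\<forall>x\<in>X. c \<le> cmod (multiplier x)" by (rule multiplier_bounded_below)
  obtain N where N [rule_format]: "\<forall>x\<in>X. \<exists>n\<in>{1..N}. 2 \<le> cmod (cocycle n x)" by (rule cocycle_doubles)
  have low: "c ^ n \<le> cmod (cocycle n x)" if "x \<in> X" for n x
    by (induction n) (use c(1) in \<open>auto simp: norm_mult intro!: mult_mono c(3) iterate_X that\<close>)
  have key: "2 ^ j * c ^ N \<le> cmod (cocycle n x)" if "x \<in> X" "j * N \<le> n" for n x j
    using that
  proof (induction n arbitrary: x j rule: less_induct)
    case (less n)
    show ?case
    proof (cases "n < N")
      case True
      then have "j * N < 1 * N" using less.prems(2) unfolding mult_1 by linarith
      then have "j < 1" by (rule mult_less_cancel2[THEN iffD1, THEN conjunct2])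
      then have "j = 0" by simp
      moreover have "c ^ N \<le> c ^ n" using True c by (intro power_decreasing) auto
      ultimately show ?thesis using low[OF less.prems(1), of n] by simp
    next
      case False
      obtain m where m: "m \<in> {1..N}" "2 \<le> cmod (cocycle m x)" using N[OF less.prems(1)] by blast
      have "(j - 1) * N \<le> n - m"
      proof (cases j)
        case (Suc i)
        then have "i * N + N \<le> n" "m \<le> N" using less.prems(2) m(1) by simp_all
        then show ?thesis unfolding Suc diff_Suc_1 by linarith
      qed simp
      then have "2 ^ (j - 1) * c ^ N \<le> cmod (cocycle (n - m) ((f ^^ m) x))"
        using m(1) False by (intro less.IH iterate_X less.prems(1)) auto
      then have "(2 ^ (j - 1) * c ^ N) * 2 \<le> cmod (cocycle (n - m) ((f ^^ m) x)) * cmod (cocycle m x)"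
        using m(2) c(1) by (intro mult_mono) auto
      also have "\<dots> = cmod (cocycle n x)"
        using cocycle_add[of "n - m" m x] m(1) False by (simp add: norm_mult)
      finally have "2 ^ Suc (j - 1) * c ^ N \<le> cmod (cocycle n x)" by (simp add: algebra_simps)
      moreover have "(2::real) ^ j \<le> 2 ^ Suc (j - 1)" by (intro power_increasing) auto
      then have "2 ^ j * c ^ N \<le> 2 ^ Suc (j - 1) * c ^ N" using c(1) by (intro mult_right_mono) auto
      ultimately show ?thesis by linarith
    qed
  qed
  obtain j where j: "M / c ^ N < 2 ^ j" using real_arch_pow[of 2] by auto
  have "M \<le> cmod (cocycle n x)" if "j * N \<le> n" "x \<in> X" for n x
  proof -
    have "M < 2 ^ j * c ^ N" using j c(1) by (simp add: divide_simps)
    then show ?thesis using key[OF that(2,1)] by linarith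
  qed
  then show ?thesis by (intro that[of "j * N"]) auto
qed

lemma iterates_expand:
  assumes "0 < \<rho>"
  obtains n0 where "\<forall>n\<ge>n0. \<forall>x\<in>X. \<exists>z\<in>cball 0 \<rho>. R \<le> dist ((f ^^ n) (\<psi> x z)) ((f ^^ n) x)"
proof -
  obtain \<rho>o where \<rho>o [rule_format]: "0 < \<rho>o" "\<forall>x\<in>X. \<exists>z\<in>cball 0 \<rho>o. R \<le> dist (\<psi> x z) x" by (rule discs_leave_ball)
  obtain n0 where n0 [rule_format]: "\<forall>n\<ge>n0. \<forall>x\<in>X. \<rho>o / \<rho> \<le> cmod (cocycle n x)"
    by (rule cocycle_tends_to_infinity)
  show ?thesis
  proof (rule that[of n0], intro allI impI ballI)
    fix n x assume n: "n0 \<le> n" and x: "x \<in> X"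
    obtain z where z: "cmod z \<le> \<rho>o" "R \<le> dist (\<psi> ((f ^^ n) x) z) ((f ^^ n) x)"
      using \<rho>o(2)[OF iterate_X[OF x, of n]] by auto
    show "\<exists>z\<in>cball 0 \<rho>. R \<le> dist ((f ^^ n) (\<psi> x z)) ((f ^^ n) x)"
    proof
      show "R \<le> dist ((f ^^ n) (\<psi> x (z / cocycle n x))) ((f ^^ n) x)"
        using z(2) cocycle_nonzero[OF x] by (simp add: iterate_conjugacy x)
      have "\<rho>o \<le> \<rho> * cmod (cocycle n x)" using n0[OF n x] assms by (simp add: divide_simps mult.commute)
      then have "cmod z \<le> \<rho> * cmod (cocycle n x)" using z(1) by linarith
      then show "z / cocycle n x \<in> cball 0 \<rho>"
        using cocycle_nonzero[OF x, of n] by (simp add: norm_divide divide_simps)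
    qed
  qed
qed

lemma inverse_iterates_contract:
  assumes "0 < e"
  obtains n0 where "\<forall>n\<ge>n0. \<forall>x\<in>X. \<forall>z\<in>cball 0 \<sigma>.
    dist ((inv f ^^ n) (\<psi> x z)) ((inv f ^^ n) x) \<le> e"
proof -
  obtain d where d: "d > 0" "\<And>x z. x \<in> X \<Longrightarrow> cmod z \<le> d \<Longrightarrow> dist (\<psi> x z) x < e"
    using equicontinuous_at_centre[OF assms] by (metis mem_cball_0)
  obtain n0 where n0 [rule_format]: "\<forall>n\<ge>n0. \<forall>x\<in>X. \<sigma> / d \<le> cmod (cocycle n x)"
    by (rule cocycle_tends_to_infinity)
  show ?thesis
  proof (rule that[of n0], intro allI impI ballI)
    fix n x and z :: complex assume n: "n0 \<le> n" and x: "x \<in> X" and z: "z \<in> cball 0 \<sigma>"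
    define y where "y = (inv f ^^ n) x"
    have y: "y \<in> X" unfolding y_def by (rule inv_iterate_X[OF x])
    have "\<psi> x z = (f ^^ n) (\<psi> y (z / cocycle n y))"
      using cocycle_nonzero[OF y, of n] iterate_inv_iterate[of n x]
      unfolding iterate_conjugacy[OF y] by (simp add: y_def)
    then have eq: "(inv f ^^ n) (\<psi> x z) = \<psi> y (z / cocycle n y)" by (simp add: inv_iterate_iterate)
    have "\<sigma> \<le> d * cmod (cocycle n y)" using n0[OF n y] d(1) by (simp add: divide_simps mult.commute)
    then have "cmod z \<le> d * cmod (cocycle n y)" using z by simp
    then have "cmod (z / cocycle n y) \<le> d"
      using cocycle_nonzero[OF y, of n] by (simp add: norm_divide divide_simps)
    then show "dist ((inv f ^^ n) (\<psi> x z)) ((inv f ^^ n) x) \<le> e"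
      using d(2)[OF y] unfolding eq y_def[symmetric] by (meson less_imp_le)
  qed
qed

lemma limit_iterates_expand:
  assumes x: "\<And>n. x n \<in> X" and lim: "loc_unif_limit (\<lambda>n. \<psi> (x n)) g" and \<rho>: "0 < \<rho>"
  obtains n0 where "\<forall>n\<ge>n0. \<exists>z\<in>cball 0 \<rho>. R \<le> dist ((f ^^ n) (g z)) ((f ^^ n) (g 0))"
proof -
  have g: "entire_curve g" by (rule loc_unif_limit_entire[OF lim]) (simp add: entire_member x)
  obtain n0 where n0 [rule_format]: "\<forall>n\<ge>n0. \<forall>x\<in>X.
      \<exists>z\<in>cball 0 \<rho>. R \<le> dist ((f ^^ n) (\<psi> x z)) ((f ^^ n) x)"
    by (rule iterates_expand[OF \<rho>])
  show ?thesis
  proof (rule that[of n0], intro allI impI)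
    fix n assume n: "n0 \<le> n"
    have "\<exists>z. \<forall>m. z m \<in> cball 0 \<rho> \<and> R \<le> dist ((f ^^ n) (\<psi> (x m) (z m))) ((f ^^ n) (x m))"
      using n0[OF n x] by (intro choice) blast
    then obtain z where z: "\<And>m. z m \<in> cball 0 \<rho>"
      "\<And>m. R \<le> dist ((f ^^ n) (\<psi> (x m) (z m))) ((f ^^ n) (x m))" by blast
    obtain zl k where k: "zl \<in> cball 0 \<rho>" "strict_mono (k :: nat \<Rightarrow> nat)" "(z \<circ> k) \<longlonglongrightarrow> zl"
      using compact_cball[of "0::complex" \<rho>, unfolded compact_def] z(1) by metis
    have lim': "loc_unif_limit (\<lambda>m. \<psi> (x (k m))) g"
      using loc_unif_limit_subseq[OF lim k(2)] by (simp add: o_def)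
    have "(\<lambda>m. \<psi> (x (k m)) (z (k m))) \<longlonglongrightarrow> g zl"
      using loc_unif_limit_tendsto_diagonal[OF lim' entire_curve_continuous[OF g] k(3)] by simp
    moreover have "(\<lambda>m. x (k m)) \<longlonglongrightarrow> g 0"
      using loc_unif_limit_tendsto[OF lim', of 0] by (simp add: centre x)
    ultimately have "(\<lambda>m. dist ((f ^^ n) (\<psi> (x (k m)) (z (k m)))) ((f ^^ n) (x (k m)))) \<longlonglongrightarrow>
        dist ((f ^^ n) (g zl)) ((f ^^ n) (g 0))"
      by (intro tendsto_dist continuous_on_tendsto_compose[OF iterate_cont]) auto
    then have "R \<le> dist ((f ^^ n) (g zl)) ((f ^^ n) (g 0))"
      by (rule Lim_bounded2[where N = 0]) (use z(2) in auto)
    then show "\<exists>z\<in>cball 0 \<rho>. R \<le> dist ((f ^^ n) (g z)) ((f ^^ n) (g 0))" using k(1) by blast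
  qed
qed

lemma limit_inverse_iterates_contract:
  assumes x: "\<And>n. x n \<in> X" and lim: "loc_unif_limit (\<lambda>n. \<psi> (x n)) g" and e: "0 < e"
  obtains n0 where "\<forall>n\<ge>n0. \<forall>z\<in>cball 0 \<sigma>.
    dist ((inv f ^^ n) (g z)) ((inv f ^^ n) (g 0)) \<le> e"
proof -
  obtain n0 where n0 [rule_format]: "\<forall>n\<ge>n0. \<forall>x\<in>X. \<forall>z\<in>cball 0 \<sigma>.
      dist ((inv f ^^ n) (\<psi> x z)) ((inv f ^^ n) x) \<le> e"
    by (rule inverse_iterates_contract[OF e])
  show ?thesis
  proof (rule that[of n0], intro allI impI ballI)
    fix n and z :: complex assume n: "n0 \<le> n" and z: "z \<in> cball 0 \<sigma>"
    have "x \<longlonglongrightarrow> g 0" using loc_unif_limit_tendsto[OF lim, of 0] by (simp add: centre x)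
    then have "(\<lambda>m. dist ((inv f ^^ n) (\<psi> (x m) z)) ((inv f ^^ n) (x m))) \<longlonglongrightarrow>
        dist ((inv f ^^ n) (g z)) ((inv f ^^ n) (g 0))"
      by (intro tendsto_dist continuous_on_tendsto_compose[OF inv_iterate_cont] loc_unif_limit_tendsto[OF lim]) auto
    then show "dist ((inv f ^^ n) (g z)) ((inv f ^^ n) (g 0)) \<le> e"
      by (rule Lim_bounded[where M = 0]) (use n0[OF n x z] in auto)
  qed
qed

end

section \<open>Local product structure\<close>

text \<open>For the inverse map the closure of \<open>K_plus f\<close> takes the role of \<open>Q\<close>, because the backward orbits under
\<open>inv f\<close> are the forward orbits under \<open>f\<close>.\<close>
lemma henon_unstable_families:
  assumes f: "henon_map f" and X: "compact X"
  shows "quasi_expanding_via f X \<psi> \<Longrightarrow> admissible_radius (\<psi> ` X) R \<Longrightarrow>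
      unstable_family f X \<psi> (closure (K_minus f)) R"
    and "quasi_contracting_via f X \<psi> \<Longrightarrow> admissible_radius (\<psi> ` X) R \<Longrightarrow>
      unstable_family (inv f) X \<psi> (closure (K_plus f)) R"
proof -
  have facts: "bij f" "continuous_on UNIV f" "continuous_on UNIV (inv f)" "preserves_entire f" "preserves_entire (inv f)"
    and "\<exists>T>0. vertical_escape T f \<and> vertical_escape T (prod.swap \<circ> inv f \<circ> prod.swap)"
    using henon_map_facts[OF f] by auto
  then obtain T where T: "T > 0" "vertical_escape T f" "vertical_escape T (prod.swap \<circ> inv f \<circ> prod.swap)" by blast
  have ii: "inv (inv f) = f" using facts(1) by (rule inv_inv_eq)
  have bd: "bounded (K_plus f \<inter> closure (K_minus f))" "bounded (K_plus (inv f) \<inter> closure (K_plus f))"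
    using escaping_sets_meet_in_bounded_set[OF T] unfolding K_minus_def by (simp_all add: Int_commute)
  show "unstable_family f X \<psi> (closure (K_minus f)) R"
    if q: "quasi_expanding_via f X \<psi>" and R: "admissible_radius (\<psi> ` X) R"
  proof
    show "range (\<psi> x) \<subseteq> closure (K_minus f)" if "x \<in> X" for x
      using q that unfolding quasi_expanding_via_def J_minus_def frontier_def by blast
  qed (use facts X q R bd in \<open>auto simp only: quasi_expanding_via_def closed_closure\<close>)
  show "unstable_family (inv f) X \<psi> (closure (K_plus f)) R"
    if q: "quasi_contracting_via f X \<psi>" and R: "admissible_radius (\<psi> ` X) R"
  proof
    have q': "quasi_expanding_via (inv f) X \<psi>" using q unfolding quasi_contracting_via_def .
    show "range (\<psi> x) \<subseteq> closure (K_plus f)" if "x \<in> X" for x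
      using q' that unfolding quasi_expanding_via_def J_minus_def frontier_def K_minus_def ii by blast
    show "bij (inv f)" using facts(1) by (rule bij_imp_bij_inv)
    show "continuous_on UNIV (inv (inv f))" unfolding ii by (rule facts(2))
  qed (use facts X q R bd in \<open>auto simp only: quasi_contracting_via_def quasi_expanding_via_def closed_closure\<close>)
qed

text \<open>Backward iteration shrinks a disc of a limit \<open>gu\<close> of unstable curves to a point, but stretches every
disc of a limit \<open>gs\<close> of stable curves to size \<open>R\<close>.\<close>
lemma stable_unstable_limits_differ:
  assumes U: "unstable_family f X \<psi>u Qu R" and S: "unstable_family (inv f) X \<psi>s Qs R"
    and x: "\<And>n. x n \<in> X" "\<And>n. y n \<in> X"
    and lim: "loc_unif_limit (\<lambda>n. \<psi>s (x n)) gs" "loc_unif_limit (\<lambda>n. \<psi>u (y n)) gu" and eq: "gs 0 = gu 0"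
  shows "\<not> (\<exists>\<rho>>0. gs ` ball 0 \<rho> \<subseteq> gu ` ball 0 \<sigma>)"
proof
  assume "\<exists>\<rho>>0. gs ` ball 0 \<rho> \<subseteq> gu ` ball 0 \<sigma>"
  then obtain \<rho> where \<rho>: "\<rho> > 0" "gs ` ball 0 \<rho> \<subseteq> gu ` ball 0 \<sigma>" by blast
  interpret U: unstable_family f X \<psi>u Qu R by (rule U)
  interpret S: unstable_family "inv f" X \<psi>s Qs R by (rule S)
  have \<rho>2: "\<rho> / 2 > 0" and R2: "R / 2 > 0" using \<rho>(1) U.R_pos by auto
  obtain n1 where n1: "\<forall>n\<ge>n1. \<exists>z\<in>cball 0 (\<rho> / 2). R \<le> dist ((inv f ^^ n) (gs z)) ((inv f ^^ n) (gs 0))"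
    by (rule S.limit_iterates_expand[of x gs "\<rho> / 2", OF x(1) lim(1) \<rho>2])
  obtain n2 where n2: "\<forall>n\<ge>n2. \<forall>w\<in>cball 0 \<sigma>. dist ((inv f ^^ n) (gu w)) ((inv f ^^ n) (gu 0)) \<le> R / 2"
    by (rule U.limit_inverse_iterates_contract[of y gu "R / 2", OF x(2) lim(2) R2])
  let ?n = "max n1 n2"
  obtain z where z: "cmod z \<le> \<rho> / 2" "R \<le> dist ((inv f ^^ ?n) (gs z)) ((inv f ^^ ?n) (gs 0))"
    using n1[rule_format, of ?n] by auto
  have "z \<in> ball 0 \<rho>" using z(1) \<rho>(1) by simp
  then obtain w where w: "w \<in> ball 0 \<sigma>" "gs z = gu w" using \<rho>(2) by blast
  have "dist ((inv f ^^ ?n) (gu w)) ((inv f ^^ ?n) (gu 0)) \<le> R / 2"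
    using n2[rule_format, of ?n w] w(1) by simp
  then show False using z(2) R2 unfolding w(2) eq by linarith
qed

theorem proposition3p6:
  fixes f :: "C2 \<Rightarrow> C2" and X :: "C2 set"
    and \<psi>s \<psi>u :: "C2 \<Rightarrow> complex \<Rightarrow> C2" and rhat r r1 :: real
  assumes "henon_map f"
    and "compact X"
    and "quasi_hyperbolic_via f X \<psi>s \<psi>u"
    and "admissible_radius (\<psi>u ` X) rhat"
    and "admissible_radius (\<psi>s ` X) rhat"
    and "r < rhat"
    and "0 < r1" and "r1 < r"
  shows "\<exists>r0>0. r0 \<le> r1 \<and>
    (\<forall>c. \<forall>x'\<in>ball c r0 \<inter> X. \<forall>x''\<in>ball c r0 \<inter> X.
       local_manifold (\<psi>s x') r \<inter> local_manifold (\<psi>u x'') r \<inter> ball c r1 \<noteq> {})"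
proof -
  have qh: "quasi_contracting_via f X \<psi>s" "quasi_expanding_via f X \<psi>u"
    using assms(3) unfolding quasi_hyperbolic_via_def by auto
  have Ufam: "unstable_family f X \<psi>u (closure (K_minus f)) rhat"
    and Sfam: "unstable_family (inv f) X \<psi>s (closure (K_plus f)) rhat"
    using henon_unstable_families[OF assms(1,2)] qh assms(4,5) by blast+
  interpret U: unstable_family f X \<psi>u "closure (K_minus f)" rhat by (rule Ufam)
  interpret S: unstable_family "inv f" X \<psi>s "closure (K_plus f)" rhat by (rule Sfam)
  have r1h: "r1 / 2 > 0" using assms(7) by simp
  obtain du where du: "du > 0" "\<forall>x\<in>X. \<forall>z\<in>cball 0 du. dist (\<psi>u x z) x < r1 / 2"
    using U.equicontinuous_at_centre[OF r1h] by blast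
  obtain ds where ds: "ds > 0" "\<forall>x\<in>X. \<forall>z\<in>cball 0 ds. dist (\<psi>s x z) x < r1 / 2"
    using S.equicontinuous_at_centre[OF r1h] by blast
  define \<epsilon> where "\<epsilon> = min du ds"
  have \<epsilon>: "\<epsilon> > 0" "\<epsilon> \<le> du" "\<epsilon> \<le> ds" unfolding \<epsilon>_def using du ds by auto
  have near_u: "dist (\<psi>u x z) x < r1 / 2" if "x \<in> X" "z \<in> ball 0 \<epsilon>" for x z
    using du(2) that \<epsilon> by auto
  have near_s: "dist (\<psi>s x z) x < r1 / 2" if "x \<in> X" "z \<in> ball 0 \<epsilon>" for x z
    using ds(2) that \<epsilon> by auto
  have dom: "ball 0 \<epsilon> \<subseteq> param_domain (\<psi>u x) r" "ball 0 \<epsilon> \<subseteq> param_domain (\<psi>s x) r" if x: "x \<in> X" for x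
  proof -
    have "dist (\<psi>u x z) (\<psi>u x 0) < r" "dist (\<psi>s x z) (\<psi>s x 0) < r" if z: "z \<in> ball 0 \<epsilon>" for z
      using near_u[OF x z] near_s[OF x z] assms(7,8) U.centre[OF x] S.centre[OF x] by simp_all
    then show "ball 0 \<epsilon> \<subseteq> param_domain (\<psi>u x) r" "ball 0 \<epsilon> \<subseteq> param_domain (\<psi>s x) r"
      by (intro ball_subset_param_domain \<epsilon>(1); blast)+
  qed

  \<comment> \<open>Discs of radius \<open>\<epsilon>\<close> are mapped so close to their centres that any intersection of them lies in all
    the required sets.\<close>
  have "\<exists>d>0. \<forall>x\<in>X. \<forall>y\<in>X. dist x y < d \<longrightarrow> (\<exists>z\<in>ball 0 \<epsilon>. \<exists>w\<in>ball 0 \<epsilon>. \<psi>s x z = \<psi>u y w)"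
  proof (rule ccontr)
    assume none: "\<not> ?thesis"
    have "\<exists>x y. x \<in> X \<and> y \<in> X \<and> dist x y < 1 / real (Suc n) \<and>
        \<not> (\<exists>z\<in>ball 0 \<epsilon>. \<exists>w\<in>ball 0 \<epsilon>. \<psi>s x z = \<psi>u y w)" for n
    proof -
      have "1 / real (Suc n) > 0" by simp
      then show ?thesis using none by meson
    qed
    then obtain x y where xy: "\<And>n. x n \<in> X" "\<And>n. y n \<in> X" "\<And>n. dist (x n) (y n) < 1 / real (Suc n)"
      "\<And>n. \<not> (\<exists>z\<in>ball 0 \<epsilon>. \<exists>w\<in>ball 0 \<epsilon>. \<psi>s (x n) z = \<psi>u (y n) w)" by metis
    obtain k gs where k: "strict_mono k" "loc_unif_limit (\<lambda>n. \<psi>s (x (k n))) gs"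
      using S.convergent_subfamily[of x, OF xy(1)] by metis
    obtain l gu where l: "strict_mono l" "loc_unif_limit (\<lambda>n. \<psi>u (y (k (l n)))) gu"
      using U.convergent_subfamily[of "\<lambda>n. y (k n)", OF xy(2)] by metis
    have lim_s: "loc_unif_limit (\<lambda>n. \<psi>s (x (k (l n)))) gs"
      using loc_unif_limit_subseq[OF k(2) l(1)] by (simp add: o_def)
    have "(\<lambda>n. dist (x n) (y n)) \<longlonglongrightarrow> 0"
    proof (rule Lim_null_comparison)
      show "(\<lambda>n. 1 / real (Suc n)) \<longlonglongrightarrow> 0" by (rule LIMSEQ_Suc[OF lim_const_over_n])
      show "eventually (\<lambda>n. norm (dist (x n) (y n)) \<le> 1 / real (Suc n)) sequentially"
        using less_imp_le[OF xy(3)] by simp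
    qed
    then have "((\<lambda>n. dist (x n) (y n)) \<circ> (k \<circ> l)) \<longlonglongrightarrow> 0"
      by (rule LIMSEQ_subseq_LIMSEQ) (rule strict_mono_o[OF k(1) l(1)])
    then have "(\<lambda>n. dist (x (k (l n))) (y (k (l n)))) \<longlonglongrightarrow> 0" by (simp add: o_def)
    moreover have "(\<lambda>n. dist (x (k (l n))) (y (k (l n)))) \<longlonglongrightarrow> dist (gs 0) (gu 0)"
    proof (rule tendsto_dist)
      show "(\<lambda>n. x (k (l n))) \<longlonglongrightarrow> gs 0"
        using loc_unif_limit_tendsto[OF lim_s, of 0] by (simp add: S.centre xy(1))
      show "(\<lambda>n. y (k (l n))) \<longlonglongrightarrow> gu 0"
        using loc_unif_limit_tendsto[OF l(2), of 0] by (simp add: U.centre xy(2))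
    qed
    ultimately have "0 = dist (gs 0) (gu 0)" by (rule LIMSEQ_unique)
    then have eq: "gs 0 = gu 0" by simp
    obtain w0 where w0: "gu w0 \<noteq> gu 0"
      using U.limit_nonconstant[of "\<lambda>n. y (k (l n))", OF xy(2) l(2)] by blast
    have "\<not> (\<exists>\<rho>>0. gs ` ball 0 \<rho> \<subseteq> gu ` ball 0 \<epsilon>)"
      by (rule stable_unstable_limits_differ[OF Ufam Sfam _ _ lim_s l(2) eq]) (auto simp: xy)
    then have "eventually (\<lambda>n. \<exists>z\<in>ball 0 \<epsilon>. \<exists>w\<in>ball 0 \<epsilon>. \<psi>s (x (k (l n))) z = \<psi>u (y (k (l n))) w) sequentially"
      by (intro isolated_intersection_persists[OF _ _ lim_s l(2) eq w0 \<epsilon>(1)] S.entire_member U.entire_member xy)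
    then show False using xy(4) by (simp add: eventually_sequentially)
  qed
  then obtain d where d: "d > 0" "\<And>x y. x \<in> X \<Longrightarrow> y \<in> X \<Longrightarrow> dist x y < d \<Longrightarrow>
      \<exists>z\<in>ball 0 \<epsilon>. \<exists>w\<in>ball 0 \<epsilon>. \<psi>s x z = \<psi>u y w" by metis
  show ?thesis
  proof (intro exI conjI allI ballI)
    show "min (d / 2) (r1 / 2) > 0" "min (d / 2) (r1 / 2) \<le> r1" using d(1) assms(7) by auto
    fix c x' x''
    assume x': "x' \<in> ball c (min (d / 2) (r1 / 2)) \<inter> X" and x'': "x'' \<in> ball c (min (d / 2) (r1 / 2)) \<inter> X"
    have cd: "dist c x' < d / 2" "dist c x' < r1 / 2" "dist c x'' < d / 2" and X': "x' \<in> X" "x'' \<in> X"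
      using x' x'' by auto
    have "dist x' x'' < d" using cd dist_triangle3[of x' x'' c] by linarith
    then obtain z w where zw: "z \<in> ball 0 \<epsilon>" "w \<in> ball 0 \<epsilon>" "\<psi>s x' z = \<psi>u x'' w" using d(2)[OF X'] by blast
    have "dist c (\<psi>s x' z) < r1"
      using near_s[OF X'(1) zw(1)] cd(2) dist_triangle[of c "\<psi>s x' z" x'] dist_commute[of x' "\<psi>s x' z"] by linarith
    moreover have "\<psi>s x' z \<in> local_manifold (\<psi>s x') r"
      unfolding local_manifold_def using dom(2)[OF X'(1)] zw(1) by blast
    moreover have "\<psi>s x' z \<in> local_manifold (\<psi>u x'') r"
      unfolding local_manifold_def zw(3) using dom(1)[OF X'(2)] zw(2) by blast
    ultimately show "local_manifold (\<psi>s x') r \<inter> local_manifold (\<psi>u x'') r \<inter> ball c r1 \<noteq> {}" by auto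
  qed
qed

end
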